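(* Let $F:\mathbb{R}^n\times\mathbb{R}_{\ge 0}^p\times\mathbb{R}^m\to\mathbb{R}$, $(x,y,z)\mapsto F(x,y,z)$, be twice continuously differentiable and convex-concave on $\mathbb{R}^n\times(\mathbb{R}_{\ge 0}^p\times\mathbb{R}^m)$ (convex in $x$, concave in $(y,z)$), and suppose that $F$ is locally strongly convex-concave at a saddle point. Then the set $\mathrm{Saddle}(F)$ of saddle points of $F$ is globally asymptotically stable under the projected saddle-point dynamics $$\dot x=-\nabla_xF(x,y,z),\qquad \dot y=[\nabla_yF(x,y,z)]_y^+,\qquad \dot z=\nabla_zF(x,y,z),$$ and the convergence of trajectories is to a point.
   Context: For $a\in\mathbb{R}$ and $b\ge 0$, $[a]_b^+=a$ if $b>0$ and $[a]_b^+=\max\{0,a\}$ if $b=0$; for vectors $a\in\mathbb{R}^p$, $b\in\mathbb{R}_{\ge0}^p$, $[a]_b^+$ is the vector with components $[a_i]_{b_i}^+$. $F$ is convex-concave on $\mathcal{X}\times\mathcal{Y}$, with $\mathcal{X}=\mathbb{R}^n$ and $\mathcal{Y}=\mathbb{R}_{\ge0}^p\times\mathbb{R}^m$, if $x\mapsto F(x,\tilde y,\tilde z)$ is convex for each fixed $(\tilde y,\tilde z)\in\mathcal{Y}$ and $(y,z)\mapsto F(\tilde x,y,z)$ is concave for each fixed $\tilde x\in\mathcal{X}$. A point $(x_*,y_*,z_* )\in\mathcal{X}\times\mathcal{Y}$ is a saddle point of $F$ if $F(x_*,y,z)\le F(x_*,y_*,z_* )\le F(x,y_*,z_* )$ for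 all $x\in\mathcal{X}$ and $(y,z)\in\mathcal{Y}$. $F$ is locally strongly convex-concave at a saddle point $(x_*,y_*,z_* )$ if it is convex-concave and, for some constant $c>0$, either $\nabla_{xx}F(x_*,y_*,z_* )\succeq cI$ or the Hessian of $F$ with respect to $(y,z)$, namely $\begin{bmatrix}\nabla_{yy}F&\nabla_{yz}F\\\nabla_{zy}F&\nabla_{zz}F\end{bmatrix}$, evaluated at $(x_*,y_*,z_* )$, is $\preceq -cI$. Trajectories are Caratheodory solutions: absolutely continuous maps (with values in $\mathbb{R}^n\times\mathbb{R}_{\ge0}^p\times\mathbb{R}^m$) satisfying the differential equation almost everywhere. Global asymptotic stability is relative to the domain $\mathbb{R}^n\times\mathbb{R}_{\ge0}^p\times\mathbb{R}^m$: the set is Lyapunov stable and every trajectory starting in the domain converges to it. "Convergence to a point" means each trajectory converges to some single point of $\mathrm{Saddle}(F)$ (which may depend on the trajectory). *)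

theory Defs
  imports "HOL-Analysis.Analysis"
begin

section \<open>Differentiation on sets that need not be open\<close>

text \<open>
  All derivatives are taken within the domain \<open>S\<close>. The sets used below are products of
  whole spaces with the closed nonnegative orthant, on which the derivative within \<open>S\<close>
  is unique also at boundary points (cf. \<open>frechet_derivative_unique_within\<close>).
\<close>

definition grad_on :: "'a::euclidean_space set \<Rightarrow> ('a \<Rightarrow> real) \<Rightarrow> 'a \<Rightarrow> 'a" where
  "grad_on S f x = (\<Sum>b\<in>Basis. frechet_derivative f (at x within S) b *\<^sub>R b)"

definition hess_on :: "'a::euclidean_space set \<Rightarrow> ('a \<Rightarrow> real) \<Rightarrow> 'a \<Rightarrow> 'a \<Rightarrow> 'a" where
  "hess_on S f x = frechet_derivative (grad_on S f) (at x within S)"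

definition C2_on :: "'a::real_normed_vector set \<Rightarrow> ('a \<Rightarrow> real) \<Rightarrow> bool" where
  "C2_on S f \<longleftrightarrow>
    (\<exists>(f' :: 'a \<Rightarrow> 'a \<Rightarrow>\<^sub>L real) (f'' :: 'a \<Rightarrow> 'a \<Rightarrow>\<^sub>L ('a \<Rightarrow>\<^sub>L real)).
      (\<forall>x\<in>S. (f has_derivative blinfun_apply (f' x)) (at x within S)) \<and>
      (\<forall>x\<in>S. (f' has_derivative blinfun_apply (f'' x)) (at x within S)) \<and>
      continuous_on S f'')"

text \<open>
  The Loewner order. Symmetry of the operators is not part of the definition; the Hessians
  of \<open>C\<^sup>2\<close> functions to which it is applied are symmetric.
\<close>

definition loewner_le :: "('a::real_inner \<Rightarrow> 'a) \<Rightarrow> ('a \<Rightarrow> 'a) \<Rightarrow> bool" where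
  "loewner_le A B \<longleftrightarrow> (\<forall>h. h \<bullet> A h \<le> h \<bullet> B h)"


section \<open>Convex-concave functions and saddle points\<close>

type_synonym ('n, 'p, 'm) state = "(real ^ 'n) \<times> (real ^ 'p) \<times> (real ^ 'm)"

definition nonneg_orthant :: "(real ^ 'p) set" where
  "nonneg_orthant = {y. \<forall>i. 0 \<le> y $ i}"

definition YZ_dom :: "((real ^ 'p::finite) \<times> (real ^ 'm::finite)) set" where
  "YZ_dom = nonneg_orthant \<times> UNIV"

definition state_dom :: "('n::finite, 'p::finite, 'm::finite) state set" where
  "state_dom = UNIV \<times> YZ_dom"

definition convex_concave :: "(('n::finite, 'p::finite, 'm::finite) state \<Rightarrow> real) \<Rightarrow> bool" where
  "convex_concave F \<longleftrightarrow>
    (\<forall>yz\<in>YZ_dom. convex_on UNIV (\<lambda>x. F (x, yz))) \<and>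
    (\<forall>x. concave_on YZ_dom (\<lambda>yz. F (x, yz)))"

definition Saddle :: "(('n::finite, 'p::finite, 'm::finite) state \<Rightarrow> real) \<Rightarrow> ('n, 'p, 'm) state set" where
  "Saddle F = {(xs, ys, zs). (xs, ys, zs) \<in> state_dom \<and>
    (\<forall>(y, z)\<in>YZ_dom. F (xs, y, z) \<le> F (xs, ys, zs)) \<and>
    (\<forall>x. F (xs, ys, zs) \<le> F (x, ys, zs))}"

definition grad_x :: "(('n::finite, 'p::finite, 'm::finite) state \<Rightarrow> real) \<Rightarrow> ('n, 'p, 'm) state \<Rightarrow> real ^ 'n" where
  "grad_x F = (\<lambda>(x, y, z). grad_on UNIV (\<lambda>x. F (x, y, z)) x)"

definition grad_y :: "(('n::finite, 'p::finite, 'm::finite) state \<Rightarrow> real) \<Rightarrow> ('n, 'p, 'm) state \<Rightarrow> real ^ 'p" where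
  "grad_y F = (\<lambda>(x, y, z). grad_on nonneg_orthant (\<lambda>y. F (x, y, z)) y)"

definition grad_z :: "(('n::finite, 'p::finite, 'm::finite) state \<Rightarrow> real) \<Rightarrow> ('n, 'p, 'm) state \<Rightarrow> real ^ 'm" where
  "grad_z F = (\<lambda>(x, y, z). grad_on UNIV (\<lambda>z. F (x, y, z)) z)"

definition hess_xx ::
  "(('n::finite, 'p::finite, 'm::finite) state \<Rightarrow> real) \<Rightarrow> ('n, 'p, 'm) state \<Rightarrow> real ^ 'n \<Rightarrow> real ^ 'n" where
  "hess_xx F = (\<lambda>(x, yz). hess_on UNIV (\<lambda>x. F (x, yz)) x)"

text \<open>The full Hessian in \<open>(y, z)\<close>, including the mixed blocks.\<close>

definition hess_yz ::
  "(('n::finite, 'p::finite, 'm::finite) state \<Rightarrow> real) \<Rightarrow> ('n, 'p, 'm) state \<Rightarrow>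
    (real ^ 'p) \<times> (real ^ 'm) \<Rightarrow> (real ^ 'p) \<times> (real ^ 'm)" where
  "hess_yz F = (\<lambda>(x, yz). hess_on YZ_dom (\<lambda>yz. F (x, yz)) yz)"

definition locally_strongly_convex_concave ::
  "(('n::finite, 'p::finite, 'm::finite) state \<Rightarrow> real) \<Rightarrow> ('n, 'p, 'm) state \<Rightarrow> bool" where
  "locally_strongly_convex_concave F s \<longleftrightarrow> convex_concave F \<and>
    (\<exists>c>0. loewner_le (\<lambda>h. c *\<^sub>R h) (hess_xx F s) \<or> loewner_le (hess_yz F s) (\<lambda>h. - c *\<^sub>R h))"


section \<open>The projected saddle-point dynamics\<close>

definition proj_plus :: "real \<Rightarrow> real \<Rightarrow> real" where
  "proj_plus a b = (if b > 0 then a else max 0 a)"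

definition proj_plus_vec :: "real ^ 'p \<Rightarrow> real ^ 'p \<Rightarrow> real ^ 'p" where
  "proj_plus_vec a b = (\<chi> i. proj_plus (a $ i) (b $ i))"

definition saddle_field :: "(('n::finite, 'p::finite, 'm::finite) state \<Rightarrow> real) \<Rightarrow> ('n, 'p, 'm) state \<Rightarrow> ('n, 'p, 'm) state" where
  "saddle_field F = (\<lambda>(x, y, z).
    (- grad_x F (x, y, z), proj_plus_vec (grad_y F (x, y, z)) y, grad_z F (x, y, z)))"

text \<open>
  The usual \<open>\<epsilon>\<close>-\<open>\<delta>\<close> notion: a division \<open>d division_of t\<close> is a finite family of compact
  intervals with pairwise disjoint interiors and union \<open>t\<close>.
\<close>

definition absolutely_continuous_on :: "real set \<Rightarrow> (real \<Rightarrow> 'a::metric_space) \<Rightarrow> bool" where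
  "absolutely_continuous_on S f \<longleftrightarrow>
    (\<forall>\<epsilon>>0. \<exists>\<delta>>0. \<forall>d t. d division_of t \<and> t \<subseteq> S \<and> (\<Sum>k\<in>d. measure lborel k) < \<delta> \<longrightarrow>
      (\<Sum>k\<in>d. dist (f (Inf k)) (f (Sup k))) < \<epsilon>)"

text \<open>
  Caratheodory solutions on \<open>[0, \<infinity>)\<close> with values in \<open>D\<close>; absolute continuity is required
  on compact time intervals.
\<close>

definition caratheodory_solutions ::
  "'a::real_normed_vector set \<Rightarrow> ('a \<Rightarrow> 'a) \<Rightarrow> (real \<Rightarrow> 'a) set" where
  "caratheodory_solutions D G = {\<gamma>.
    (\<forall>t\<ge>0. \<gamma> t \<in> D) \<and>
    (\<forall>T\<ge>0. absolutely_continuous_on {0..T} \<gamma>) \<and>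
    (AE t in lebesgue_on {0..}. (\<gamma> has_vector_derivative G (\<gamma> t)) (at t within {0..}))}"

definition lyapunov_stable :: "(real \<Rightarrow> 'a::metric_space) set \<Rightarrow> 'a set \<Rightarrow> bool" where
  "lyapunov_stable \<Gamma> A \<longleftrightarrow>
    (\<forall>\<epsilon>>0. \<exists>\<delta>>0. \<forall>\<gamma>\<in>\<Gamma>. infdist (\<gamma> 0) A < \<delta> \<longrightarrow> (\<forall>t\<ge>0. infdist (\<gamma> t) A < \<epsilon>))"

definition globally_asymptotically_stable :: "(real \<Rightarrow> 'a::metric_space) set \<Rightarrow> 'a set \<Rightarrow> bool" where
  "globally_asymptotically_stable \<Gamma> A \<longleftrightarrow>
    lyapunov_stable \<Gamma> A \<and> (\<forall>\<gamma>\<in>\<Gamma>. ((\<lambda>t. infdist (\<gamma> t) A) \<longlongrightarrow> 0) at_top)"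

definition saddle_trajectories ::
  "(('n::finite, 'p::finite, 'm::finite) state \<Rightarrow> real) \<Rightarrow> (real \<Rightarrow> ('n, 'p, 'm) state) set" where
  "saddle_trajectories F = caratheodory_solutions state_dom (saddle_field F)"

end

theory Submission
  imports Defs
begin

text \<open>
  Write \<open>w = (y, z)\<close> and \<open>W = YZ_dom\<close>. Convexity in \<open>x\<close>, concavity in \<open>w\<close> and the sign of the
  projection term on the boundary of the orthant show that a trajectory satisfies, for almost
  every time and for all \<open>v\<close> and all \<open>u \<in> W\<close>,
  \<open>F (x, w) - F (v, w) \<le> x' \<bullet> (v - x)\<close> and \<open>F (x, u) - F (x, w) \<le> w' \<bullet> (u - w)\<close>
  (\<open>saddle_field_variational\<close>). These inequalities drive the convergence argument.

  For a saddle point \<open>(p, q)\<close>, adding the two inequalities with \<open>v = p\<close> and \<open>u = q\<close> shows that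
  half the squared distance to \<open>(p, q)\<close> decreases at least at the rate
  \<open>F (x, q) - F (p, w) \<ge> 0\<close> (\<open>fejer\<close>). So the distance to every saddle point is nonincreasing,
  which gives Lyapunov stability and boundedness, and by a Barbalat argument the rate tends to
  zero (\<open>gap_vanishes\<close>): \<open>F (x, q)\<close> tends to the minimum of \<open>F (\<cdot>, q)\<close> and \<open>F (p, w)\<close> to the
  maximum of \<open>F (p, \<cdot>)\<close>.

  Local strong convexity or concavity at \<open>(p, q)\<close> makes \<open>p\<close> the only minimizer of \<open>F (\<cdot>, q)\<close> or
  \<open>q\<close> the only maximizer of \<open>F (p, \<cdot>)\<close> (\<open>locally_strong_saddle_unique\<close>). By symmetry consider the
  first case; then \<open>x\<close> converges to \<open>p\<close>. A second application of the Barbalat argument, now to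
  the convergent distance from \<open>x\<close> to an arbitrary \<open>v\<close>, shows that \<open>p\<close> minimizes \<open>F (\<cdot>, l)\<close> for
  every cluster point \<open>l\<close> of \<open>w\<close>. So \<open>(p, l)\<close> is a saddle point, and since the distance to it is
  nonincreasing, the whole trajectory converges to it (\<open>tendsto_saddle_point\<close>).

  Integrating these differential inequalities along a Caratheodory solution needs one fact about
  absolutely continuous functions: a lower bound on the derivative almost everywhere bounds the
  increment (\<open>absolutely_continuous_growth\<close>).
\<close>

section \<open>Absolutely continuous functions with derivative bounds almost everywhere\<close>

text \<open>
  The fundamental theorem of calculus for absolutely continuous functions, in the one-sided form
  that differential inequalities use. Around a point where the derivative
  exists, the increment over a small interval is at least \<open>c - e\<close> times its length. The
  exceptional points are covered by an open set of small measure, and absolute continuity makes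
  the total variation over intervals inside that set small. A tagged division fine for the
  resulting gauge adds the two kinds of increments up.
\<close>

lemma absolutely_continuous_growth:
  fixes f :: "real \<Rightarrow> real"
  assumes ac: "absolutely_continuous_on {a..b} f" and "a \<le> b" and N: "negligible N"
    and der: "\<And>t. t \<in> {a..b} - N \<Longrightarrow> \<exists>d\<ge>c. (f has_vector_derivative d) (at t within {a..b})"
  shows "c * (b - a) \<le> f b - f a"
proof -
  define C where "C = 1 + \<bar>c\<bar> + (b - a)"
  have approx: "c * (b - a) - e * C \<le> f b - f a" if "e > 0" for e
  proof -
    obtain \<delta> where "\<delta> > 0" and \<delta>: "\<And>d t. \<lbrakk>d division_of t; t \<subseteq> {a..b}; (\<Sum>k\<in>d. measure lborel k) < \<delta>\<rbrakk>
        \<Longrightarrow> (\<Sum>k\<in>d. dist (f (Inf k)) (f (Sup k))) < e"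
      using ac \<open>e > 0\<close> unfolding absolutely_continuous_on_def by meson
    \<comment> \<open>The intervals tagged in \<open>N\<close> must be short in total for two reasons: below \<open>\<delta>\<close> their variation
      is small, and below \<open>e\<close> the missing part of \<open>c * (b - a)\<close> is small.\<close>
    define \<eta> where "\<eta> = min \<delta> e"
    have "\<eta> > 0" using \<open>\<delta> > 0\<close> \<open>e > 0\<close> by (simp add: \<eta>_def)
    obtain U where U: "open U" "N \<subseteq> U" "U - N \<in> lmeasurable" "emeasure lebesgue (U - N) < ennreal \<eta>"
      using sets_lebesgue_outer_open[OF negligible_imp_sets[OF N] \<open>\<eta> > 0\<close>] by metis
    have UN: "(U - N) \<union> N = U" using U(2) by auto
    have Um: "U \<in> lmeasurable"
      using fmeasurable.Un[OF U(3) negligible_imp_measurable[OF N]] UN by simp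
    have "measure lebesgue (U - N) < \<eta>"
      using U(3,4) \<open>\<eta> > 0\<close> by (simp add: emeasure_eq_measure2 ennreal_less_iff)
    moreover have "measure lebesgue U = measure lebesgue (U - N)"
      by (metis N UN U(3) measure_Un_null_set negligible_iff_null_sets fmeasurableD)
    ultimately have U\<eta>: "measure lebesgue U < \<eta>" by simp
    have "\<exists>g>0. if t \<in> N then ball t g \<subseteq> U else t \<in> {a..b} \<longrightarrow>
        (\<forall>u v. u \<le> t \<and> t \<le> v \<and> {u..v} \<subseteq> {a..b} \<and> {u..v} \<subseteq> ball t g \<longrightarrow>
          c * (v - u) - e * (v - u) \<le> f v - f u)" for t
    proof (cases "t \<in> N")
      case True
      then show ?thesis using U(1,2) openE by (metis subsetD)
    next
      case tN: False
      show ?thesis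
      proof (cases "t \<in> {a..b}")
        case True
        then obtain d where d: "d \<ge> c" "(f has_vector_derivative d) (at t within {a..b})"
          using der tN by blast
        then obtain g where "g > 0" and g: "\<And>y. y \<in> {a..b} \<Longrightarrow> norm (y - t) < g \<Longrightarrow>
            norm (f y - f t - (y - t) *\<^sub>R d) \<le> e * norm (y - t)"
          using \<open>e > 0\<close> unfolding has_vector_derivative_def has_derivative_within_alt by meson
        have "c * (v - u) - e * (v - u) \<le> f v - f u"
          if "u \<le> t" "t \<le> v" "{u..v} \<subseteq> {a..b}" "{u..v} \<subseteq> ball t g" for u v
        proof -
          have "u \<in> {u..v}" "v \<in> {u..v}" using that by auto
          then have "u \<in> {a..b}" "v \<in> {a..b}" "norm (u - t) < g" "norm (v - t) < g"
            using that(3,4) unfolding subset_iff mem_ball dist_norm by (metis norm_minus_commute)+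
          then have "norm (f u - f t - (u - t) *\<^sub>R d) \<le> e * norm (u - t)"
            "norm (f v - f t - (v - t) *\<^sub>R d) \<le> e * norm (v - t)"
            using g by blast+
          then have "f v - f u \<ge> d * (v - u) - e * (v - u)"
            using that by (simp add: algebra_simps abs_le_iff)
          moreover have "d * (v - u) \<ge> c * (v - u)"
            using d that by (intro mult_right_mono) auto
          ultimately show ?thesis by linarith
        qed
        then show ?thesis using \<open>g > 0\<close> tN by auto
      qed (use tN in \<open>auto intro: zero_less_one\<close>)
    qed
    then obtain g where gpos: "\<And>t. g t > 0" and gN: "\<And>t. t \<in> N \<Longrightarrow> ball t (g t) \<subseteq> U"
      and gd: "\<And>t u v. \<lbrakk>t \<notin> N; t \<in> {a..b}; u \<le> t; t \<le> v; {u..v} \<subseteq> {a..b}; {u..v} \<subseteq> ball t (g t)\<rbrakk>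
        \<Longrightarrow> c * (v - u) - e * (v - u) \<le> f v - f u"
      by metis
    obtain p where p: "p tagged_division_of {a..b}" and fine: "(\<lambda>t. ball t (g t)) fine p"
      using fine_division_exists_real[OF gauge_ball_dependent] gpos by metis
    have finp: "finite p" using p by blast
    define q where "q = {(t, K) \<in> p. t \<in> N}"
    have qp: "q \<subseteq> p" by (auto simp: q_def)
    then have qpart: "q tagged_partial_division_of {a..b}"
      using p tagged_partial_division_subset tagged_division_of_def by blast
    then have qtag: "q tagged_division_of \<Union>(snd ` q)"
      by (rule tagged_partial_division_of_Union_self)
    then have qdiv: "snd ` q division_of \<Union>(snd ` q)"
      by (rule division_of_tagged_division)
    have K: "\<exists>u v. K = {u..v} \<and> u \<le> t \<and> t \<le> v \<and> {u..v} \<subseteq> {a..b} \<and> Inf K = u \<and> Sup K = v \<and> measure lborel K = v - u"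
      if tK: "(t, K) \<in> p" for t K
    proof -
      obtain u v where "K = {u..v}" "t \<in> K" "K \<subseteq> {a..b}"
        using tagged_division_ofD(2-4)[OF p tK] by auto
      then show ?thesis by force
    qed
    have sub: "\<Union>(snd ` q) \<subseteq> {a..b}" using K qp by fastforce
    have "\<Union>(snd ` q) \<subseteq> U"
      using fine gN unfolding q_def fine_def by fastforce
    have len: "(\<Sum>k\<in>snd ` q. measure lborel k) < \<eta>"
    proof -
      have "(\<Sum>k\<in>snd ` q. measure lborel k) = (\<Sum>k\<in>snd ` q. measure lebesgue k)"
        using qdiv by (intro sum.cong refl) (auto dest: division_ofD(4))
      also have "\<dots> = measure lebesgue (\<Union>(snd ` q))"
        using content_division[OF qdiv] .
      also have "\<dots> \<le> measure lebesgue U"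
        using \<open>\<Union>(snd ` q) \<subseteq> U\<close> Um lmeasurable_division[OF qdiv] by (intro measure_mono_fmeasurable) auto
      finally show ?thesis using U\<eta> by simp
    qed
    \<comment> \<open>Several tags may share one degenerate interval, so sums over \<open>q\<close> and over its set of intervals
      agree for summands that vanish on intervals with empty interior. In the second computation
      this is why the summand is set to zero on the empty interval, where \<open>Inf\<close> and \<open>Sup\<close> are
      arbitrary.\<close>
    have lenq: "(\<Sum>(t, K)\<in>q. measure lborel K) < \<eta>"
      using len by (subst sum.over_tagged_division_lemma[OF qtag])
        (auto simp: content_eq_0_interior)
    have "(\<Sum>(t, K)\<in>q. dist (f (Inf K)) (f (Sup K)))
        = (\<Sum>(t, K)\<in>q. if K = {} then 0 else dist (f (Inf K)) (f (Sup K)))"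
      using K qp by (intro sum.cong) fastforce+
    also have "\<dots> = (\<Sum>K\<in>snd ` q. if K = {} then 0 else dist (f (Inf K)) (f (Sup K)))"
      by (subst sum.over_tagged_division_lemma[OF qtag]) (auto simp: le_less)
    also have "\<dots> \<le> (\<Sum>K\<in>snd ` q. dist (f (Inf K)) (f (Sup K)))"
      by (intro sum_mono) auto
    also have "\<dots> < e"
      using \<delta>[OF qdiv sub] len by (simp add: \<eta>_def)
    finally have varq: "(\<Sum>(t, K)\<in>q. dist (f (Inf K)) (f (Sup K))) < e" .
    let ?h = "\<lambda>K. f (Sup K) - f (Inf K) - c * measure lborel K"
    have "f b - f a = (\<Sum>(t, K)\<in>p. f (Sup K) - f (Inf K))"
      using additive_tagged_division_1[OF \<open>a \<le> b\<close> p, of f] by simp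
    moreover have "b - a = (\<Sum>(t, K)\<in>p. Sup K - Inf K)"
      using additive_tagged_division_1[OF \<open>a \<le> b\<close> p, of "\<lambda>x. x"] by simp
    moreover have "(\<Sum>(t, K)\<in>p. Sup K - Inf K) = (\<Sum>(t, K)\<in>p. measure lborel K)"
      using K by (intro sum.cong) fastforce+
    ultimately have tot: "f b - f a - c * (b - a) = (\<Sum>(t, K)\<in>p. ?h K)"
      and lenp: "b - a = (\<Sum>(t, K)\<in>p. measure lborel K)"
      by (simp_all add: sum_subtractf sum_distrib_left split_def)
    have split: "(\<Sum>(t, K)\<in>p. ?h K) = (\<Sum>(t, K)\<in>p - q. ?h K) + (\<Sum>(t, K)\<in>q. ?h K)"
      by (rule sum.subset_diff[OF qp finp])
    have "- e * (b - a) \<le> - e * (\<Sum>(t, K)\<in>p - q. measure lborel K)"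
      unfolding lenp using \<open>e > 0\<close> finp by (simp add: split_def sum_mono2)
    also have "\<dots> \<le> (\<Sum>(t, K)\<in>p - q. ?h K)"
      unfolding sum_distrib_left
    proof (intro sum_mono, clarify)
      fix t K assume tK: "(t, K) \<in> p" "(t, K) \<notin> q"
      then obtain u v where uv: "K = {u..v}" "u \<le> t" "t \<le> v" "{u..v} \<subseteq> {a..b}" "Inf K = u" "Sup K = v"
        "measure lborel K = v - u" using K by blast
      moreover have "t \<notin> N" "K \<subseteq> ball t (g t)" using tK fine by (auto simp: q_def fine_def)
      moreover have "t \<in> {a..b}" using uv by auto
      ultimately show "- e * measure lborel K \<le> ?h K"
        using gd[of t u v] by simp
    qed
    finally have 1: "- e * (b - a) \<le> (\<Sum>(t, K)\<in>p - q. ?h K)" .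
    have "- e - \<bar>c\<bar> * e \<le> - (\<Sum>(t, K)\<in>q. dist (f (Inf K)) (f (Sup K))) - \<bar>c\<bar> * (\<Sum>(t, K)\<in>q. measure lborel K)"
    proof -
      have "\<bar>c\<bar> * (\<Sum>(t, K)\<in>q. measure lborel K) \<le> \<bar>c\<bar> * e"
        using lenq by (intro mult_left_mono) (auto simp: \<eta>_def)
      then show ?thesis using varq by linarith
    qed
    also have "\<dots> = (\<Sum>(t, K)\<in>q. - dist (f (Inf K)) (f (Sup K)) - \<bar>c\<bar> * measure lborel K)"
      by (simp add: sum_subtractf sum_distrib_left split_def sum_negf)
    also have "\<dots> \<le> (\<Sum>(t, K)\<in>q. ?h K)"
    proof (intro sum_mono, clarify)
      fix t :: real and K :: "real set"
      have "c * measure lborel K \<le> \<bar>c\<bar> * measure lborel K"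
        by (intro mult_right_mono) auto
      then show "- dist (f (Inf K)) (f (Sup K)) - \<bar>c\<bar> * measure lborel K \<le> ?h K"
        by (simp add: dist_real_def)
    qed
    finally show ?thesis using 1 tot split by (simp add: C_def algebra_simps)
  qed
  have "C > 0" using \<open>a \<le> b\<close> by (simp add: C_def)
  show ?thesis
  proof (rule field_le_epsilon)
    fix e :: real assume "e > 0"
    then show "c * (b - a) \<le> f b - f a + e"
      using approx[of "e / C"] \<open>C > 0\<close> by simp
  qed
qed

lemma absolutely_continuous_on_subset:
  "absolutely_continuous_on S f \<Longrightarrow> T \<subseteq> S \<Longrightarrow> absolutely_continuous_on T f"
  unfolding absolutely_continuous_on_def by (meson subset_trans)

lemma absolutely_continuous_imp_continuous_on:
  fixes f :: "real \<Rightarrow> 'a::metric_space"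
  assumes "absolutely_continuous_on {a..b} f"
  shows "continuous_on {a..b} f"
proof -
  have "\<exists>\<delta>>0. \<forall>s\<in>{a..b}. \<forall>t\<in>{a..b}. dist t s < \<delta> \<longrightarrow> dist (f t) (f s) < e" if "e > 0" for e
  proof -
    obtain \<delta> where "\<delta> > 0" and \<delta>: "\<And>d t. \<lbrakk>d division_of t; t \<subseteq> {a..b}; (\<Sum>k\<in>d. measure lborel k) < \<delta>\<rbrakk>
        \<Longrightarrow> (\<Sum>k\<in>d. dist (f (Inf k)) (f (Sup k))) < e"
      using assms \<open>e > 0\<close> unfolding absolutely_continuous_on_def by meson
    have ord: "dist (f s) (f t) < e" if "a \<le> s" "s \<le> t" "t \<le> b" "t - s < \<delta>" for s t
    proof -
      have "{{s..t}} division_of {s..t}"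
        using division_of_self[of s t] that by simp
      from \<delta>[OF this] that show ?thesis by auto
    qed
    have "dist (f t) (f s) < e" if "s \<in> {a..b}" "t \<in> {a..b}" "dist t s < \<delta>" for s t
      using ord[of s t] ord[of t s] that by (cases "s \<le> t") (auto simp: dist_commute dist_real_def)
    then show ?thesis using \<open>\<delta> > 0\<close> by blast
  qed
  then have "uniformly_continuous_on {a..b} f"
    unfolding uniformly_continuous_on_def by (intro allI impI)
  then show ?thesis
    by (rule uniformly_continuous_imp_continuous)
qed

lemma absolutely_continuous_on_lipschitz_compose:
  fixes f :: "real \<Rightarrow> 'a::metric_space" and h :: "'a \<Rightarrow> 'b::metric_space"
  assumes ac: "absolutely_continuous_on S f"
    and lip: "\<And>s t. s \<in> S \<Longrightarrow> t \<in> S \<Longrightarrow> dist (h (f s)) (h (f t)) \<le> L * dist (f s) (f t)"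
  shows "absolutely_continuous_on S (\<lambda>t. h (f t))"
  unfolding absolutely_continuous_on_def
proof (intro allI impI)
  fix e :: real assume "e > 0"
  define M where "M = \<bar>L\<bar> + 1"
  have "M > 0" by (simp add: M_def)
  have lipM: "dist (h (f s)) (h (f t)) \<le> M * dist (f s) (f t)" if "s \<in> S" "t \<in> S" for s t
  proof -
    have "L * dist (f s) (f t) \<le> M * dist (f s) (f t)"
      by (intro mult_right_mono) (auto simp: M_def)
    then show ?thesis using lip[OF that] by linarith
  qed
  obtain \<delta> where "\<delta> > 0" and \<delta>: "\<And>d t. \<lbrakk>d division_of t; t \<subseteq> S; (\<Sum>k\<in>d. measure lborel k) < \<delta>\<rbrakk>
      \<Longrightarrow> (\<Sum>k\<in>d. dist (f (Inf k)) (f (Sup k))) < e / M"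
    using ac divide_pos_pos[OF \<open>e > 0\<close> \<open>M > 0\<close>] unfolding absolutely_continuous_on_def by meson
  have var: "(\<Sum>k\<in>d. dist (h (f (Inf k))) (h (f (Sup k)))) < e"
    if d: "d division_of t" "t \<subseteq> S" "(\<Sum>k\<in>d. measure lborel k) < \<delta>" for d t
  proof -
    have mem: "Inf k \<in> S \<and> Sup k \<in> S" if k: "k \<in> d" for k
    proof -
      obtain u v where "k = {u..v}" "k \<noteq> {}" "k \<subseteq> t"
        using division_ofD(2-4)[OF d(1) k] by auto
      then have "Inf k \<in> k" "Sup k \<in> k" by auto
      then show ?thesis using \<open>k \<subseteq> t\<close> d(2) by blast
    qed
    have "(\<Sum>k\<in>d. dist (h (f (Inf k))) (h (f (Sup k)))) \<le> (\<Sum>k\<in>d. M * dist (f (Inf k)) (f (Sup k)))"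
      using mem lipM by (intro sum_mono) blast
    also have "\<dots> = M * (\<Sum>k\<in>d. dist (f (Inf k)) (f (Sup k)))"
      by (simp add: sum_distrib_left)
    also have "\<dots> < e"
      using \<delta>[OF d] \<open>M > 0\<close> by (simp add: pos_less_divide_eq mult.commute)
    finally show ?thesis .
  qed
  show "\<exists>\<delta>>0. \<forall>d t. d division_of t \<and> t \<subseteq> S \<and> (\<Sum>k\<in>d. measure lborel k) < \<delta> \<longrightarrow>
      (\<Sum>k\<in>d. dist (h (f (Inf k))) (h (f (Sup k)))) < e"
  proof (intro exI[of _ \<delta>] conjI allI impI)
    show "\<delta> > 0" by fact
  qed (elim conjE, rule var)
qed

text \<open>
  The squared distance to \<open>v\<close> is a Lipschitz function on the bounded range of the curve, hence
  again absolutely continuous along it, and its derivative is controlled by the inner product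
  in the hypothesis.
\<close>

lemma half_square_distance_decay:
  fixes p :: "real \<Rightarrow> 'a::real_inner"
  assumes ac: "absolutely_continuous_on {a..b} p" and "a \<le> b" and N: "negligible N"
    and der: "\<And>t. t \<in> {a..b} - N \<Longrightarrow>
      \<exists>p'. (p has_vector_derivative p') (at t within {a..b}) \<and> c \<le> p' \<bullet> (v - p t)"
  shows "(dist (p b) v)\<^sup>2 / 2 \<le> (dist (p a) v)\<^sup>2 / 2 - c * (b - a)"
proof -
  define E where "E u = - ((u - v) \<bullet> (u - v)) / 2" for u
  have "bounded (p ` {a..b})"
    by (intro compact_imp_bounded compact_continuous_image absolutely_continuous_imp_continuous_on ac) auto
  then have "bounded ((\<lambda>u. u - v) ` (p ` {a..b}))"
    by (rule bounded_translation_minus)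
  then obtain M where "\<forall>y\<in>(\<lambda>u. u - v) ` (p ` {a..b}). norm y \<le> M"
    unfolding bounded_iff by blast
  then have M: "norm (p t - v) \<le> M" if "t \<in> {a..b}" for t
    using that by simp
  have "dist (E (p s)) (E (p t)) \<le> M * dist (p s) (p t)" if "s \<in> {a..b}" "t \<in> {a..b}" for s t
  proof -
    let ?s = "p s - v" and ?t = "p t - v"
    have "(a - b) \<bullet> (b + a) = a \<bullet> a - b \<bullet> b" for a b :: 'a
      by (simp add: inner_diff_left inner_add_right inner_commute[of b a])
    from this[of ?t ?s] have E_diff: "E (p s) - E (p t) = (?t - ?s) \<bullet> (?s + ?t) / 2"
      unfolding E_def by argo
    have "dist (E (p s)) (E (p t)) = \<bar>(?t - ?s) \<bullet> (?s + ?t)\<bar> / 2"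
      unfolding dist_real_def E_diff by simp
    also have "\<dots> \<le> norm (?t - ?s) * norm (?s + ?t) / 2"
      using Cauchy_Schwarz_ineq2[of "?t - ?s" "?s + ?t"] by simp
    also have "\<dots> \<le> norm (?t - ?s) * (2 * M) / 2"
      using M[OF that(1)] M[OF that(2)] norm_triangle_ineq[of ?s ?t]
      by (intro divide_right_mono mult_left_mono) auto
    finally show ?thesis
      by (simp add: dist_norm norm_minus_commute mult.commute)
  qed
  then have "absolutely_continuous_on {a..b} (\<lambda>t. E (p t))"
    by (rule absolutely_continuous_on_lipschitz_compose[OF ac])
  moreover have "\<exists>d\<ge>c. ((\<lambda>t. E (p t)) has_vector_derivative d) (at t within {a..b})"
    if t: "t \<in> {a..b} - N" for t
  proof -
    obtain p' where p': "(p has_vector_derivative p') (at t within {a..b})" "c \<le> p' \<bullet> (v - p t)"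
      using der[OF t] by blast
    have "((\<lambda>t. E (p t)) has_vector_derivative (p' \<bullet> (v - p t))) (at t within {a..b})"
      using p'(1) unfolding E_def has_vector_derivative_def
      by (auto intro!: derivative_eq_intros simp: fun_eq_iff inner_diff_right inner_diff_left inner_commute field_simps)
    then show ?thesis using p'(2) by blast
  qed
  ultimately have "c * (b - a) \<le> E (p b) - E (p a)"
    using absolutely_continuous_growth[OF _ \<open>a \<le> b\<close> N] by blast
  then show ?thesis
    by (simp add: E_def dist_norm power2_norm_eq_inner)
qed

text \<open>
  A one-sided form of Barbalat's lemma. The dissipation rate \<open>g\<close> may be negative, but whenever it
  reaches \<open>e\<close> it stays above \<open>e / 2\<close> for a uniform time \<open>\<tau> / 2\<close>, which costs the energy the fixed
  amount \<open>e \<tau> / 4\<close>; a convergent energy cannot pay this at arbitrarily late times.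
\<close>

lemma barbalat_decay:
  fixes E g :: "real \<Rightarrow> real"
  assumes decay: "\<And>a b c. 0 \<le> a \<Longrightarrow> a \<le> b \<Longrightarrow> (\<And>t. t \<in> {a..b} \<Longrightarrow> c \<le> g t) \<Longrightarrow> E b \<le> E a - c * (b - a)"
    and lim: "(E \<longlongrightarrow> l) at_top" and uc: "uniformly_continuous_on {0..} g" and "e > 0"
  shows "\<forall>\<^sub>F t in at_top. g t < e"
proof -
  obtain \<tau> where "\<tau> > 0" and \<tau>: "\<And>s t. \<lbrakk>s \<in> {0..}; t \<in> {0..}; dist t s < \<tau>\<rbrakk> \<Longrightarrow> dist (g t) (g s) < e / 2"
    using uc half_gt_zero[OF \<open>e > 0\<close>] unfolding uniformly_continuous_on_def by metis
  have "e * \<tau> / 8 > 0" using \<open>e > 0\<close> \<open>\<tau> > 0\<close> by simp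
  then obtain T where T: "\<And>t. t \<ge> T \<Longrightarrow> dist (E t) l < e * \<tau> / 8"
    using tendstoD[OF lim] unfolding eventually_at_top_linorder by meson
  have "g t < e" if t: "t \<ge> max 0 T" for t
  proof (rule ccontr)
    assume "\<not> g t < e"
    have "e / 2 \<le> g s" if "s \<in> {t..t + \<tau> / 2}" for s
    proof -
      have "\<bar>g s - g t\<bar> < e / 2"
        using \<tau>[of t s] that t \<open>\<tau> > 0\<close> by (auto simp: dist_real_def)
      then show ?thesis using \<open>\<not> g t < e\<close> by linarith
    qed
    then have "E (t + \<tau> / 2) \<le> E t - e / 2 * (\<tau> / 2)"
      using decay[of t "t + \<tau> / 2" "e / 2"] t \<open>\<tau> > 0\<close> by simp
    then show False
      using T[of t] T[of "t + \<tau> / 2"] t \<open>\<tau> > 0\<close> unfolding dist_real_def by linarith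
  qed
  then show ?thesis unfolding eventually_at_top_linorder by blast
qed

lemma antimono_bounded_below_tendsto:
  fixes E :: "real \<Rightarrow> real"
  assumes mono: "\<And>a b. 0 \<le> a \<Longrightarrow> a \<le> b \<Longrightarrow> E b \<le> E a" and bound: "\<And>t. 0 \<le> t \<Longrightarrow> m \<le> E t"
  shows "\<exists>l. (E \<longlongrightarrow> l) at_top"
proof -
  have bdd: "bdd_below (E ` {0..})" using bound by (intro bdd_belowI[of _ m]) auto
  have "(E \<longlongrightarrow> (INF t\<in>{0..}. E t)) at_top"
  proof (rule decreasing_tendsto)
    show "\<forall>\<^sub>F t in at_top. (INF t\<in>{0..}. E t) \<le> E t"
      using eventually_ge_at_top[of 0] by eventually_elim (auto intro: cINF_lower[OF bdd])
    fix y assume "(INF t\<in>{0..}. E t) < y"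
    then obtain s where "s \<ge> 0" "E s < y"
      using cINF_less_iff[OF _ bdd] by auto
    show "\<forall>\<^sub>F t in at_top. E t < y"
      using eventually_ge_at_top[of s]
    proof eventually_elim
      case (elim t)
      then show ?case using mono[OF \<open>s \<ge> 0\<close> elim] \<open>E s < y\<close> by linarith
    qed
  qed
  then show ?thesis ..
qed

section \<open>Flows governed by evolution variational inequalities\<close>

definition saddle_points :: "'a set \<Rightarrow> 'b set \<Rightarrow> ('a \<times> 'b \<Rightarrow> real) \<Rightarrow> ('a \<times> 'b) set" where
  "saddle_points X W F = {(p, q). p \<in> X \<and> q \<in> W \<and>
    (\<forall>w\<in>W. F (p, w) \<le> F (p, q)) \<and> (\<forall>x\<in>X. F (p, q) \<le> F (x, q))}"

text \<open>
  The dynamics is described by two variational inequalities, one for each player, which bound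
  differences of values of \<open>F\<close>. For a smooth convex-concave \<open>F\<close> they express gradient
  descent-ascent projected onto \<open>X \<times> W\<close>: convexity turns gradients into differences of values,
  and the projection acts favourably when tested against points of the domain. In this form the
  two players are interchangeable.
\<close>

locale saddle_flow =
  fixes X :: "'a::euclidean_space set" and W :: "'b::euclidean_space set"
    and F :: "'a \<times> 'b \<Rightarrow> real" and x :: "real \<Rightarrow> 'a" and w :: "real \<Rightarrow> 'b" and N :: "real set"
  assumes closed_X: "closed X" and closed_W: "closed W"
    and continuous_F: "continuous_on (X \<times> W) F"
    and x_in: "\<And>t. t \<ge> 0 \<Longrightarrow> x t \<in> X" and w_in: "\<And>t. t \<ge> 0 \<Longrightarrow> w t \<in> W"
    and ac: "\<And>T. T \<ge> 0 \<Longrightarrow> absolutely_continuous_on {0..T} (\<lambda>t. (x t, w t))"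
    and negligible_N: "negligible N"
    and evi: "\<And>t. t \<ge> 0 \<Longrightarrow> t \<notin> N \<Longrightarrow> \<exists>x' w'.
      ((\<lambda>t. (x t, w t)) has_vector_derivative (x', w')) (at t within {0..}) \<and>
      (\<forall>v\<in>X. F (x t, w t) - F (v, w t) \<le> x' \<bullet> (v - x t)) \<and>
      (\<forall>v\<in>W. F (x t, v) - F (x t, w t) \<le> w' \<bullet> (v - w t))"
begin

text \<open>
  Exchanging the players turns uniqueness of the maximizer into uniqueness of the minimizer, so
  that only one of the two cases has to be studied.
\<close>

lemma swapped: "saddle_flow W X (\<lambda>(v, u). - F (u, v)) w x N"
proof
  show "continuous_on (W \<times> X) (\<lambda>(v, u). - F (u, v))"
    unfolding split_def
    by (intro continuous_on_minus continuous_on_compose2[OF continuous_F] continuous_intros) auto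
  show "absolutely_continuous_on {0..T} (\<lambda>t. (w t, x t))" if "T \<ge> 0" for T
    using absolutely_continuous_on_lipschitz_compose[OF ac[OF that], of prod.swap 1]
    by (simp add: dist_Pair_Pair add.commute)
  show "\<exists>w' x'. ((\<lambda>t. (w t, x t)) has_vector_derivative (w', x')) (at t within {0..}) \<and>
      (\<forall>v\<in>W. (case (w t, x t) of (v, u) \<Rightarrow> - F (u, v)) - (case (v, x t) of (v, u) \<Rightarrow> - F (u, v)) \<le> w' \<bullet> (v - w t)) \<and>
      (\<forall>v\<in>X. (case (w t, v) of (v, u) \<Rightarrow> - F (u, v)) - (case (w t, x t) of (v, u) \<Rightarrow> - F (u, v)) \<le> x' \<bullet> (v - x t))"
    if t: "t \<ge> 0" "t \<notin> N" for t
  proof -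
    obtain x' w' where d: "((\<lambda>t. (x t, w t)) has_vector_derivative (x', w')) (at t within {0..})"
      and v: "\<forall>v\<in>X. F (x t, w t) - F (v, w t) \<le> x' \<bullet> (v - x t)"
        "\<forall>v\<in>W. F (x t, v) - F (x t, w t) \<le> w' \<bullet> (v - w t)"
      using evi[OF t] by blast
    have "bounded_linear (prod.swap :: 'a \<times> 'b \<Rightarrow> 'b \<times> 'a)"
      unfolding prod.swap_def by (intro bounded_linear_Pair bounded_linear_fst bounded_linear_snd)
    from bounded_linear.has_vector_derivative[OF this d]
    have "((\<lambda>t. (w t, x t)) has_vector_derivative (w', x')) (at t within {0..})" by simp
    then show ?thesis using v by auto
  qed
qed (fact closed_X closed_W x_in w_in negligible_N)+

lemma decay_x:
  assumes "v \<in> X" "0 \<le> a" "a \<le> b" "\<And>t. t \<in> {a..b} \<Longrightarrow> c \<le> F (x t, w t) - F (v, w t)"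
  shows "(dist (x b) v)\<^sup>2 / 2 \<le> (dist (x a) v)\<^sup>2 / 2 - c * (b - a)"
proof (rule half_square_distance_decay[OF _ \<open>a \<le> b\<close> negligible_N])
  have sub: "{a..b} \<subseteq> {0..b}" "{a..b} \<subseteq> {0..}" using assms by auto
  have "absolutely_continuous_on {a..b} (\<lambda>t. (x t, w t))"
    using ac assms sub by (intro absolutely_continuous_on_subset[OF ac[of b]]) auto
  from absolutely_continuous_on_lipschitz_compose[OF this, of fst 1]
  show "absolutely_continuous_on {a..b} x"
    using dist_fst_le[of "(x s, w s)" "(x t, w t)" for s t] by simp
  show "\<exists>p'. (x has_vector_derivative p') (at t within {a..b}) \<and> c \<le> p' \<bullet> (v - x t)"
    if t: "t \<in> {a..b} - N" for t
  proof -
    have t0: "t \<ge> 0" "t \<notin> N" "t \<in> {a..b}" using t assms by auto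
    then obtain x' w' where d: "((\<lambda>t. (x t, w t)) has_vector_derivative (x', w')) (at t within {0..})"
      and v: "\<forall>v\<in>X. F (x t, w t) - F (v, w t) \<le> x' \<bullet> (v - x t)"
      using evi by blast
    from bounded_linear.has_vector_derivative[OF bounded_linear_fst d]
    have "(x has_vector_derivative x') (at t within {a..b})"
      using has_vector_derivative_within_subset[OF _ sub(2)] by simp
    moreover have "c \<le> x' \<bullet> (v - x t)"
      using v assms(1) assms(4)[OF t0(3)] by force
    ultimately show ?thesis by blast
  qed
qed

lemma decay_joint:
  assumes "v \<in> X" "u \<in> W" "0 \<le> a" "a \<le> b" "\<And>t. t \<in> {a..b} \<Longrightarrow> c \<le> F (x t, u) - F (v, w t)"
  shows "(dist (x b, w b) (v, u))\<^sup>2 / 2 \<le> (dist (x a, w a) (v, u))\<^sup>2 / 2 - c * (b - a)"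
proof (rule half_square_distance_decay[OF _ \<open>a \<le> b\<close> negligible_N, of "\<lambda>t. (x t, w t)"])
  have sub: "{a..b} \<subseteq> {0..b}" "{a..b} \<subseteq> {0..}" using assms by auto
  show "absolutely_continuous_on {a..b} (\<lambda>t. (x t, w t))"
    using ac assms sub by (intro absolutely_continuous_on_subset[OF ac[of b]]) auto
  show "\<exists>p'. ((\<lambda>t. (x t, w t)) has_vector_derivative p') (at t within {a..b}) \<and>
      c \<le> p' \<bullet> ((v, u) - (x t, w t))" if t: "t \<in> {a..b} - N" for t
  proof -
    have t0: "t \<ge> 0" "t \<notin> N" "t \<in> {a..b}" using t assms by auto
    then obtain x' w' where d: "((\<lambda>t. (x t, w t)) has_vector_derivative (x', w')) (at t within {0..})"
      and v: "\<forall>v\<in>X. F (x t, w t) - F (v, w t) \<le> x' \<bullet> (v - x t)"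
        "\<forall>v\<in>W. F (x t, v) - F (x t, w t) \<le> w' \<bullet> (v - w t)"
      using evi by blast
    have "c \<le> (x', w') \<bullet> ((v, u) - (x t, w t))"
      using v(1)[rule_format, OF assms(1)] v(2)[rule_format, OF assms(2)] assms(5)[OF t0(3)] by simp
    then show ?thesis
      using has_vector_derivative_within_subset[OF d sub(2)] by blast
  qed
qed

context
  fixes p :: 'a and q :: 'b
  assumes saddle: "(p, q) \<in> saddle_points X W F"
begin

lemma saddleD:
  "p \<in> X" "q \<in> W" "v \<in> W \<Longrightarrow> F (p, v) \<le> F (p, q)" "u \<in> X \<Longrightarrow> F (p, q) \<le> F (u, q)"
  using saddle by (auto simp: saddle_points_def)

text \<open>
  Tested against a saddle point, the sum of the two inequalities has the nonnegative rate
  \<open>F (x t, q) - F (p, w t)\<close>; hence no trajectory ever moves away from any saddle point.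
\<close>

lemma fejer:
  assumes "0 \<le> a" "a \<le> b"
  shows "dist (x b, w b) (p, q) \<le> dist (x a, w a) (p, q)"
proof -
  have "0 \<le> F (x t, q) - F (p, w t)" if "t \<in> {a..b}" for t
    using saddleD(3)[of "w t"] saddleD(4)[of "x t"] w_in[of t] x_in[of t] assms that by auto
  from decay_joint[OF saddleD(1,2) assms this]
  show ?thesis by (simp add: power_mono_iff)
qed

definition "initial_dist = dist (x 0, w 0) (p, q)"

lemma in_balls:
  assumes "t \<ge> 0" shows "x t \<in> X \<inter> cball p initial_dist" "w t \<in> W \<inter> cball q initial_dist"
  using fejer[of 0 t] assms x_in w_in dist_fst_le[of "(x t, w t)" "(p, q)"] dist_snd_le[of "(x t, w t)" "(p, q)"]
  by (auto simp: initial_dist_def dist_commute)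

lemma compact_balls: "compact (X \<inter> cball p initial_dist)" "compact (W \<inter> cball q initial_dist)"
  using closed_X closed_W by (auto simp: closed_Int_compact)

text \<open>
  Boundedness of \<open>F\<close> on the compact set that contains the trajectory suffices here: testing the
  inequalities against the position at time \<open>a\<close> shows that the squared displacement grows at
  most linearly in time, a Hoelder estimate with exponent \<open>1/2\<close>.
\<close>

lemma trajectory_uniformly_continuous:
  "uniformly_continuous_on {0..} (\<lambda>t. (x t, w t))"
proof -
  have "bounded (F ` ((X \<inter> cball p initial_dist) \<times> (W \<inter> cball q initial_dist)))"
    using continuous_F compact_balls
    by (intro compact_imp_bounded compact_continuous_image compact_Times) (auto intro: continuous_on_subset)
  then obtain M where "M > 0" and M: "\<And>u v. u \<in> X \<inter> cball p initial_dist \<Longrightarrow> v \<in> W \<inter> cball q initial_dist \<Longrightarrow> \<bar>F (u, v)\<bar> \<le> M"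
    unfolding bounded_pos by auto
  have hoelder: "(dist (x b, w b) (x a, w a))\<^sup>2 \<le> 4 * M * (b - a)" if "0 \<le> a" "a \<le> b" for a b
  proof -
    have "- (2 * M) \<le> F (x t, w a) - F (x a, w t)" if "t \<in> {a..b}" for t
      using M[OF in_balls(1)[of t] in_balls(2)[of a]] M[OF in_balls(1)[of a] in_balls(2)[of t]]
        \<open>0 \<le> a\<close> that by (auto simp: abs_le_iff)
    from decay_joint[OF _ _ that this]
    show ?thesis using x_in w_in that by simp
  qed
  show ?thesis
    unfolding uniformly_continuous_on_def
  proof (intro allI impI)
    fix e :: real assume "e > 0"
    define \<delta> where "\<delta> = e\<^sup>2 / (4 * M)"
    have "\<delta> > 0" using \<open>e > 0\<close> \<open>M > 0\<close> by (simp add: \<delta>_def)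
    have ord: "dist (x b, w b) (x a, w a) < e" if "0 \<le> a" "a \<le> b" "b - a < \<delta>" for a b
    proof -
      have "4 * M * (b - a) < e\<^sup>2" using that \<open>M > 0\<close> by (simp add: \<delta>_def field_simps)
      then show ?thesis
        using hoelder[OF that(1,2)] \<open>e > 0\<close> by (meson less_imp_le order_le_less_trans power_less_imp_less_base)
    qed
    have "dist (x b, w b) (x a, w a) < e" if "a \<in> {0..}" "b \<in> {0..}" "dist b a < \<delta>" for a b
      using ord[of a b] ord[of b a] that by (cases "a \<le> b") (auto simp: dist_commute dist_real_def)
    then show "\<exists>d>0. \<forall>a\<in>{0..}. \<forall>b\<in>{0..}. dist b a < d \<longrightarrow> dist (x b, w b) (x a, w a) < e"
      using \<open>\<delta> > 0\<close> by blast
  qed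
qed

text \<open>
  The points \<open>v\<close> and \<open>u\<close> are added to the compact sets so that the rates obtained by testing
  against arbitrary competitors, possibly far from the trajectory, are covered as well.
\<close>

lemma uniformly_continuous_along_trajectory:
  assumes "v \<in> X" "u \<in> W"
    and lip: "\<And>s t. dist (k s) (k t) \<le> dist (x s, w s) (x t, w t)"
    and k: "\<And>t. t \<ge> 0 \<Longrightarrow> k t \<in> insert v (X \<inter> cball p initial_dist) \<times> insert u (W \<inter> cball q initial_dist)"
  shows "uniformly_continuous_on {0..} (\<lambda>t. F (k t))"
proof (rule uniformly_continuous_on_compose[where f = F and g = k])
  show "uniformly_continuous_on {0..} k"
    using trajectory_uniformly_continuous lip unfolding uniformly_continuous_on_def
    by (meson order_le_less_trans)
  have "uniformly_continuous_on (insert v (X \<inter> cball p initial_dist) \<times> insert u (W \<inter> cball q initial_dist)) F"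
    using compact_balls assms(1,2)
    by (intro compact_uniformly_continuous compact_Times continuous_on_subset[OF continuous_F]) auto
  moreover have "k ` {0..} \<subseteq> insert v (X \<inter> cball p initial_dist) \<times> insert u (W \<inter> cball q initial_dist)"
    by (intro image_subsetI k) simp
  ultimately show "uniformly_continuous_on (k ` {0..}) F"
    unfolding uniformly_continuous_on_def by (meson subsetD)
qed

lemma uniformly_continuous_slices:
  assumes "v \<in> X" "u \<in> W"
  shows "uniformly_continuous_on {0..} (\<lambda>t. F (x t, u))"
    and "uniformly_continuous_on {0..} (\<lambda>t. F (v, w t))"
    and "uniformly_continuous_on {0..} (\<lambda>t. F (x t, w t))"
proof -
  have le: "dist (x s) (x t) \<le> dist (x s, w s) (x t, w t)" "dist (w s) (w t) \<le> dist (x s, w s) (x t, w t)" for s t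
    using dist_fst_le[of "(x s, w s)" "(x t, w t)"] dist_snd_le[of "(x s, w s)" "(x t, w t)"] by simp_all
  have const: "dist (a, u) (b, u) = dist a b" "dist (v, c) (v, d) = dist c d" for a b c d
    by (simp_all add: dist_Pair_Pair)
  show "uniformly_continuous_on {0..} (\<lambda>t. F (x t, u))"
    using in_balls(1) by (intro uniformly_continuous_along_trajectory[OF assms]) (auto simp: const le)
  show "uniformly_continuous_on {0..} (\<lambda>t. F (v, w t))"
    using in_balls(2) by (intro uniformly_continuous_along_trajectory[OF assms]) (auto simp: const le)
  show "uniformly_continuous_on {0..} (\<lambda>t. F (x t, w t))"
    using in_balls by (intro uniformly_continuous_along_trajectory[OF assms]) auto
qed

text \<open>
  The distance to \<open>(p, q)\<close> decreases at a rate given by this gap and is bounded below, so the gap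
  cannot persist. It is the sum of the two nonnegative terms \<open>F (x t, q) - F (p, q)\<close> and
  \<open>F (p, q) - F (p, w t)\<close>, each of which therefore vanishes in the limit.
\<close>

lemma gap_vanishes:
  assumes "e > 0"
  shows "\<forall>\<^sub>F t in at_top. F (x t, q) - F (p, w t) < e"
proof -
  let ?E = "\<lambda>t. (dist (x t, w t) (p, q))\<^sup>2 / 2"
  obtain l where l: "(?E \<longlongrightarrow> l) at_top"
    using antimono_bounded_below_tendsto[of ?E 0] fejer by (force simp: power_mono)
  show ?thesis
  proof (rule barbalat_decay[OF _ l])
    show "uniformly_continuous_on {0..} (\<lambda>t. F (x t, q) - F (p, w t))"
      by (intro uniformly_continuous_on_diff uniformly_continuous_slices[OF saddleD(1,2)])
  qed (use decay_joint[OF saddleD(1,2)] assms in auto)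
qed

text \<open>
  Outside any ball around \<open>p\<close>, the values \<open>F (v, q)\<close> exceed the minimum by a fixed amount on the
  compact set where the trajectory lives, whereas \<open>F (x t, q)\<close> approaches the minimum.
\<close>

lemma x_tendsto_unique_minimizer:
  assumes uniq: "\<And>v. v \<in> X \<Longrightarrow> F (v, q) = F (p, q) \<Longrightarrow> v = p"
  shows "(x \<longlongrightarrow> p) at_top"
proof (rule tendstoI)
  fix e :: real assume "e > 0"
  define S where "S = (X \<inter> cball p initial_dist) - ball p e"
  have "compact S" unfolding S_def using compact_balls by (intro compact_diff) auto
  have cont: "continuous_on S (\<lambda>v. F (v, q))"
    using saddleD(2) by (intro continuous_on_compose2[OF continuous_F] continuous_intros) (auto simp: S_def)
  obtain \<eta> where "\<eta> > 0" and \<eta>: "\<And>v. v \<in> S \<Longrightarrow> F (p, q) + \<eta> \<le> F (v, q)"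
  proof (cases "S = {}")
    case True
    then show ?thesis using that[of 1] by simp
  next
    case False
    then obtain m where m: "m \<in> S" "\<And>v. v \<in> S \<Longrightarrow> F (m, q) \<le> F (v, q)"
      using continuous_attains_inf[OF \<open>compact S\<close> _ cont] by blast
    have "F (p, q) < F (m, q)"
      using uniq[of m] saddleD(4)[of m] m(1) \<open>e > 0\<close> by (force simp: S_def less_le)
    then show ?thesis using that[of "F (m, q) - F (p, q)"] m(2) by simp
  qed
  have "\<forall>\<^sub>F t in at_top. t \<ge> 0 \<and> F (x t, q) - F (p, w t) < \<eta>"
    using gap_vanishes[OF \<open>\<eta> > 0\<close>] eventually_ge_at_top by eventually_elim auto
  then show "\<forall>\<^sub>F t in at_top. dist (x t) p < e"
  proof eventually_elim
    case (elim t)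
    then have "F (x t, q) < F (p, q) + \<eta>"
      using saddleD(3)[OF w_in[of t]] by linarith
    then have "x t \<notin> S" using \<eta> by fastforce
    then show ?case using in_balls(1)[of t] elim by (auto simp: S_def dist_commute)
  qed
qed

end

text \<open>
  Let \<open>l\<close> be a cluster point of \<open>w\<close>. The vanishing gap makes \<open>l\<close> a maximizer of \<open>F (p, \<cdot>)\<close>. Since
  \<open>x\<close> converges to \<open>p\<close>, its squared distance to every \<open>v\<close> converges too, so the rate
  \<open>F (x t, w t) - F (v, w t)\<close> at which that distance decreases is not positive in the limit: \<open>p\<close>
  minimizes \<open>F (\<cdot>, l)\<close>. Thus \<open>(p, l)\<close> is a saddle point. The distance to it is nonincreasing and
  tends to zero along a sequence of times, hence tends to zero.
\<close>

lemma tendsto_saddle_point: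
  assumes saddle: "(p, q) \<in> saddle_points X W F"
    and uniq: "\<And>v. v \<in> X \<Longrightarrow> F (v, q) = F (p, q) \<Longrightarrow> v = p"
  shows "\<exists>z \<in> saddle_points X W F. ((\<lambda>t. (x t, w t)) \<longlongrightarrow> z) at_top"
proof -
  note x_lim = x_tendsto_unique_minimizer[OF saddle uniq]
  note sD = saddleD[OF saddle]
  have "\<forall>n. w (real n) \<in> W \<inter> cball q (initial_dist p q)"
    using in_balls(2)[OF saddle] by simp
  then obtain l r where "l \<in> W \<inter> cball q (initial_dist p q)" and r: "strict_mono r"
    and "((\<lambda>n. w (real n)) \<circ> r) \<longlonglongrightarrow> l"
    using seq_compactE[OF compact_imp_seq_compact[OF compact_balls(2)[OF saddle]], of "\<lambda>n. w (real n)"]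
    by blast
  then have l: "l \<in> W" and w_lim: "(\<lambda>n. w (real (r n))) \<longlonglongrightarrow> l"
    by (auto simp: o_def)
  have r_top: "filterlim (\<lambda>n. real (r n)) at_top sequentially"
    using filterlim_compose[OF filterlim_real_sequentially filterlim_subseq[OF r]] .
  have x_lim_r: "(\<lambda>n. x (real (r n))) \<longlonglongrightarrow> p"
    using filterlim_compose[OF x_lim r_top] .
  have F_lim: "(\<lambda>n. F (k n)) \<longlonglongrightarrow> F k'"
    if "k \<longlonglongrightarrow> k'" "\<And>n. k n \<in> X \<times> W" "k' \<in> X \<times> W" for k k'
    using continuous_on_tendsto_compose[OF continuous_F that(1,3)] that(2) by simp
  have x_in_r: "x (real (r n)) \<in> X" and w_in_r: "w (real (r n)) \<in> W" for n
    using x_in w_in by auto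
  have "F (p, q) - F (p, l) \<le> 0"
  proof (rule field_le_epsilon)
    fix e :: real assume "e > 0"
    have lim: "(\<lambda>n. F (x (real (r n)), q) - F (p, w (real (r n)))) \<longlonglongrightarrow> F (p, q) - F (p, l)"
      by (intro tendsto_diff F_lim tendsto_Pair x_lim_r w_lim tendsto_const)
        (use sD l x_in_r w_in_r in auto)
    have "\<forall>\<^sub>F n in sequentially. F (x (real (r n)), q) - F (p, w (real (r n))) \<le> e"
      using eventually_compose_filterlim[OF gap_vanishes[OF saddle \<open>e > 0\<close>] r_top]
      by (rule eventually_mono) simp
    from tendsto_upperbound[OF lim this sequentially_bot]
    show "F (p, q) - F (p, l) \<le> 0 + e" by simp
  qed
  then have Fl: "F (p, l) = F (p, q)" using sD(3)[OF l] by simp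
  have "F (p, l) \<le> F (v, l)" if v: "v \<in> X" for v
  proof (rule field_le_epsilon)
    fix e :: real assume "e > 0"
    have "((\<lambda>t. (dist (x t) v)\<^sup>2 / 2) \<longlongrightarrow> (dist p v)\<^sup>2 / 2) at_top"
      by (intro tendsto_intros x_lim) auto
    moreover have "uniformly_continuous_on {0..} (\<lambda>t. F (x t, w t) - F (v, w t))"
      by (intro uniformly_continuous_on_diff uniformly_continuous_slices[OF saddle v l])
    ultimately have "\<forall>\<^sub>F t in at_top. F (x t, w t) - F (v, w t) < e"
      using barbalat_decay[of "\<lambda>t. F (x t, w t) - F (v, w t)" "\<lambda>t. (dist (x t) v)\<^sup>2 / 2"] decay_x[OF v] \<open>e > 0\<close>
      by blast
    then have ev: "\<forall>\<^sub>F n in sequentially. F (x (real (r n)), w (real (r n))) - F (v, w (real (r n))) < e"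
      using eventually_compose_filterlim r_top by fast
    have lim: "(\<lambda>n. F (x (real (r n)), w (real (r n))) - F (v, w (real (r n)))) \<longlonglongrightarrow> F (p, l) - F (v, l)"
      by (intro tendsto_diff F_lim tendsto_Pair x_lim_r w_lim tendsto_const)
        (use sD l v x_in_r w_in_r in auto)
    from ev have "\<forall>\<^sub>F n in sequentially. F (x (real (r n)), w (real (r n))) - F (v, w (real (r n))) \<le> e"
      by (rule eventually_mono) simp
    from tendsto_upperbound[OF lim this sequentially_bot]
    show "F (p, l) \<le> F (v, l) + e" by simp
  qed
  then have pl: "(p, l) \<in> saddle_points X W F"
    using sD l Fl by (auto simp: saddle_points_def)
  have "((\<lambda>t. (x t, w t)) \<longlongrightarrow> (p, l)) at_top"
  proof (rule tendstoI)
    fix e :: real assume "e > 0"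
    have "(\<lambda>n. (x (real (r n)), w (real (r n)))) \<longlonglongrightarrow> (p, l)"
      by (intro tendsto_Pair x_lim_r w_lim)
    then obtain n where "dist (x (real (r n)), w (real (r n))) (p, l) < e"
      using tendstoD[OF _ \<open>e > 0\<close>] eventually_happens'[OF sequentially_bot] by fastforce
    then have "dist (x t, w t) (p, l) < e" if "t \<ge> real (r n)" for t
      using fejer[OF pl _ that] by simp
    then show "\<forall>\<^sub>F t in at_top. dist (x t, w t) (p, l) < e"
      unfolding eventually_at_top_linorder by blast
  qed
  then show ?thesis using pl by blast
qed

end

section \<open>Derivatives within sets that are not open\<close>

text \<open>
  A condition that makes the derivative within \<open>S\<close> unique: from each point one can move a
  little within \<open>S\<close> in every coordinate direction, possibly only with one sign.
\<close>

definition coordinate_accessible :: "'a::euclidean_space set \<Rightarrow> bool" where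
  "coordinate_accessible S \<longleftrightarrow>
    (\<forall>x\<in>S. \<forall>b\<in>Basis. \<forall>e>0. \<exists>d. 0 < \<bar>d\<bar> \<and> \<bar>d\<bar> < e \<and> x + d *\<^sub>R b \<in> S)"

lemma coordinate_accessible_UNIV: "coordinate_accessible UNIV"
  unfolding coordinate_accessible_def
proof (intro ballI allI impI)
  fix x b :: 'a and e :: real assume "e > 0"
  then show "\<exists>d. 0 < \<bar>d\<bar> \<and> \<bar>d\<bar> < e \<and> x + d *\<^sub>R b \<in> UNIV"
    by (intro exI[of _ "e / 2"]) auto
qed

lemma coordinate_accessible_Times:
  assumes "coordinate_accessible S" "coordinate_accessible T"
  shows "coordinate_accessible (S \<times> T)"
  unfolding coordinate_accessible_def
proof (intro ballI allI impI)
  fix u b :: "'a \<times> 'b" and e :: real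
  assume u: "u \<in> S \<times> T" and b: "b \<in> Basis" and e: "e > 0"
  consider i where "i \<in> Basis" "b = (i, 0)" | j where "j \<in> Basis" "b = (0, j)"
    using b by (auto simp: Basis_prod_def)
  then show "\<exists>d. 0 < \<bar>d\<bar> \<and> \<bar>d\<bar> < e \<and> u + d *\<^sub>R b \<in> S \<times> T"
  proof cases
    case 1
    then obtain d where "0 < \<bar>d\<bar>" "\<bar>d\<bar> < e" "fst u + d *\<^sub>R i \<in> S"
      using assms(1) u e unfolding coordinate_accessible_def by (metis mem_Times_iff)
    then show ?thesis using 1 u by (intro exI[of _ d]) (auto simp: mem_Times_iff)
  next
    case 2
    then obtain d where "0 < \<bar>d\<bar>" "\<bar>d\<bar> < e" "snd u + d *\<^sub>R j \<in> T"
      using assms(2) u e unfolding coordinate_accessible_def by (metis mem_Times_iff)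
    then show ?thesis using 2 u by (intro exI[of _ d]) (auto simp: mem_Times_iff)
  qed
qed

lemma coordinate_accessible_nonneg_orthant:
  "coordinate_accessible (nonneg_orthant :: (real ^ 'p::finite) set)"
  unfolding coordinate_accessible_def
proof (intro ballI allI impI)
  fix y b :: "real ^ 'p" and e :: real
  assume y: "y \<in> nonneg_orthant" and b: "b \<in> Basis" and e: "e > 0"
  obtain i where "b = axis i 1" using b by (auto simp: Basis_vec_def)
  then have "y + (e / 2) *\<^sub>R b \<in> nonneg_orthant"
    using y e by (auto simp: nonneg_orthant_def axis_def)
  then show "\<exists>d. 0 < \<bar>d\<bar> \<and> \<bar>d\<bar> < e \<and> y + d *\<^sub>R b \<in> nonneg_orthant"
    using e by (intro exI[of _ "e / 2"]) auto
qed

lemma coordinate_accessible_YZ_dom: "coordinate_accessible YZ_dom"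
  unfolding YZ_dom_def
  by (intro coordinate_accessible_Times coordinate_accessible_nonneg_orthant coordinate_accessible_UNIV)

lemma grad_on_eq:
  assumes f: "(f has_derivative (\<lambda>h. g \<bullet> h)) (at x within S)"
    and S: "coordinate_accessible S" and x: "x \<in> S"
  shows "grad_on S f x = g"
proof -
  have "(f has_derivative frechet_derivative f (at x within S)) (at x within S)"
    using f frechet_derivative_works differentiable_def by blast
  then have "frechet_derivative f (at x within S) = (\<lambda>h. g \<bullet> h)"
    using S x unfolding coordinate_accessible_def
    by (intro frechet_derivative_unique_within[OF _ f]) auto
  then show ?thesis
    by (simp add: grad_on_def euclidean_representation)
qed

lemma has_derivative_hess_on:
  assumes f: "\<And>u. u \<in> S \<Longrightarrow> (f has_derivative (\<lambda>h. G u \<bullet> h)) (at u within S)"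
    and G: "G differentiable (at x within S)"
    and S: "coordinate_accessible S" and x: "x \<in> S"
  shows "(G has_derivative hess_on S f x) (at x within S)"
proof -
  have eq: "grad_on S f u = G u" if "u \<in> S" for u
    using grad_on_eq[OF f[OF that] S that] .
  obtain G' where G': "(G has_derivative G') (at x within S)"
    using G unfolding differentiable_def by blast
  have "(grad_on S f has_derivative G') (at x within S)"
    by (rule has_derivative_transform[OF x eq G'])
  then have hess: "(grad_on S f has_derivative hess_on S f x) (at x within S)"
    unfolding hess_on_def using frechet_derivative_works differentiable_def by blast
  show ?thesis
    by (rule has_derivative_transform[OF x _ hess]) (simp add: eq)
qed

section \<open>First and second order properties of convex functions\<close>

lemma has_vector_derivative_along_segment:
  assumes f: "(f has_derivative f') (at (x + t *\<^sub>R h) within S)"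
    and seg: "\<And>s. s \<in> {0..1} \<Longrightarrow> x + s *\<^sub>R h \<in> S"
  shows "((\<lambda>s. f (x + s *\<^sub>R h)) has_vector_derivative f' h) (at t within {0..1})"
proof -
  have "((\<lambda>s. x + s *\<^sub>R h) has_derivative (\<lambda>s. s *\<^sub>R h)) (at t within {0..1})"
    by (auto intro!: derivative_eq_intros)
  moreover have "(\<lambda>s. x + s *\<^sub>R h) ` {0..1} \<subseteq> S"
    using seg by blast
  ultimately have "((\<lambda>s. f (x + s *\<^sub>R h)) has_derivative (\<lambda>s. f' (s *\<^sub>R h))) (at t within {0..1})"
    by (rule has_derivative_in_compose[where f = "\<lambda>s. x + s *\<^sub>R h" and g = f, OF _ has_derivative_subset[OF f]])
  moreover have "f' (s *\<^sub>R h) = s *\<^sub>R f' h" for s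
    using f has_derivative_linear linear_scale by blast
  ultimately show ?thesis by (simp add: has_vector_derivative_def)
qed

lemma segment_in_convex:
  assumes "convex S" "x \<in> S" "y \<in> S" "s \<in> {0..1}"
  shows "x + s *\<^sub>R (y - x) \<in> S"
proof -
  have "x + s *\<^sub>R (y - x) = (1 - s) *\<^sub>R x + s *\<^sub>R y" by (simp add: algebra_simps)
  then show ?thesis using assms by (auto intro: convexD)
qed

lemma convex_on_segment_le:
  assumes "convex_on S f" "x \<in> S" "y \<in> S" "s \<in> {0..1}"
  shows "f (x + s *\<^sub>R (y - x)) \<le> f x + s * (f y - f x)"
proof -
  have "f ((1 - s) *\<^sub>R x + s *\<^sub>R y) \<le> (1 - s) * f x + s * f y"
    using convex_onD[OF assms(1)] assms(2-) by simp
  moreover have "x + s *\<^sub>R (y - x) = (1 - s) *\<^sub>R x + s *\<^sub>R y" by (simp add: algebra_simps)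
  ultimately show ?thesis by (simp add: algebra_simps)
qed

lemma convex_on_above_tangent:
  assumes f: "convex_on S f" and der: "(f has_derivative f') (at x within S)"
    and x: "x \<in> S" and y: "y \<in> S"
  shows "f x + f' (y - x) \<le> f y"
proof -
  have S: "convex S" using f by (rule convex_on_imp_convex)
  have "((\<lambda>s. f (x + s *\<^sub>R (y - x))) has_field_derivative f' (y - x)) (at 0 within {0..1})"
    using has_vector_derivative_along_segment[of f f' x 0 "y - x" S] der segment_in_convex[OF S x y]
    by (simp add: has_real_derivative_iff_has_vector_derivative)
  then have lim: "((\<lambda>s. (f (x + s *\<^sub>R (y - x)) - f x) / s) \<longlongrightarrow> f' (y - x)) (at 0 within {0..1})"
    by (simp add: has_field_derivative_iff)
  have "\<forall>\<^sub>F s in at 0 within {0..1}. (f (x + s *\<^sub>R (y - x)) - f x) / s \<le> f y - f x"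
    unfolding eventually_at_filter
  proof (intro always_eventually allI impI)
    fix s :: real assume "s \<noteq> 0" "s \<in> {0..1}"
    then show "(f (x + s *\<^sub>R (y - x)) - f x) / s \<le> f y - f x"
      using convex_on_segment_le[OF f x y, of s] by (simp add: pos_divide_le_eq mult.commute)
  qed
  moreover have "at (0::real) within {0..1} \<noteq> bot"
    by (simp add: at_within_Icc_at_right)
  ultimately have "f' (y - x) \<le> f y - f x"
    using tendsto_upperbound[OF lim] by blast
  then show ?thesis by simp
qed

text \<open>
  By convexity \<open>f\<close> is constant on the segment from \<open>x\<close> to any other minimizer \<open>y\<close>, so the derivative
  of \<open>f\<close> in the direction \<open>h = y - x\<close> vanishes along it. Differentiating once more at \<open>x\<close> gives
  \<open>h \<bullet> H h = 0\<close>, and positivity of the Hessian at the single point \<open>x\<close> forces \<open>h = 0\<close>.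
\<close>

lemma unique_minimizer_of_positive_hessian:
  fixes G :: "'a::euclidean_space \<Rightarrow> 'a"
  assumes f: "convex_on S f"
    and der: "\<And>u. u \<in> S \<Longrightarrow> (f has_derivative (\<lambda>h. G u \<bullet> h)) (at u within S)"
    and H: "(G has_derivative H) (at x within S)" and "c > 0"
    and pos: "\<And>h. c * (h \<bullet> h) \<le> h \<bullet> H h"
    and x: "x \<in> S" and min: "\<And>u. u \<in> S \<Longrightarrow> f x \<le> f u"
    and y: "y \<in> S" "f y = f x"
  shows "y = x"
proof -
  define h where "h = y - x"
  have seg: "x + s *\<^sub>R h \<in> S" if "s \<in> {0..1}" for s
    using segment_in_convex[OF convex_on_imp_convex[OF f] x y(1) that] by (simp add: h_def)
  have const: "f (x + s *\<^sub>R h) = f x" if "s \<in> {0..1}" for s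
    using convex_on_segment_le[OF f x y(1) that] min[OF seg[OF that]] y(2) by (simp add: h_def)
  have flat: "G (x + s *\<^sub>R h) \<bullet> h = 0" if s: "s \<in> {0..1}" for s
  proof -
    have "((\<lambda>s. f (x + s *\<^sub>R h)) has_vector_derivative G (x + s *\<^sub>R h) \<bullet> h) (at s within {0..1})"
      using has_vector_derivative_along_segment[OF der[OF seg[OF s]] seg] by simp
    then have "((\<lambda>s. f x) has_vector_derivative G (x + s *\<^sub>R h) \<bullet> h) (at s within {0..1})"
      by (rule has_vector_derivative_transform[OF s const[symmetric], rotated])
    then show ?thesis
      using vector_derivative_unique_within_closed_interval[of 0 1 s "\<lambda>s. f x"] s
      by (metis box_real(2) has_vector_derivative_const zero_less_one)
  qed
  have "((\<lambda>s. G (x + s *\<^sub>R h)) has_vector_derivative H h) (at 0 within {0..1})"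
    using has_vector_derivative_along_segment[of G H x 0 h S] H seg by simp
  from bounded_linear.has_vector_derivative[OF bounded_linear_inner_left this, of h]
  have "((\<lambda>s. G (x + s *\<^sub>R h) \<bullet> h) has_vector_derivative H h \<bullet> h) (at 0 within {0..1})" .
  then have "((\<lambda>s. 0) has_vector_derivative H h \<bullet> h) (at (0::real) within {0..1})"
    by (rule has_vector_derivative_transform[rotated 2]) (auto simp: flat)
  then have "H h \<bullet> h = 0"
    using vector_derivative_unique_within_closed_interval[of 0 1 0 "\<lambda>s. 0::real"]
    by (metis atLeastAtMost_iff box_real(2) has_vector_derivative_const order_refl zero_le_one zero_less_one)
  then have "h \<bullet> h \<le> 0"
    using pos[of h] \<open>c > 0\<close> by (simp add: inner_commute mult_le_0_iff)
  then have "h = 0" using inner_ge_zero[of h] by (metis antisym inner_eq_zero_iff)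
  then show ?thesis by (simp add: h_def)
qed

text \<open>
  A gradient field of the full function, from which every partial gradient and Hessian block is
  obtained by projection; it is differentiable because it depends linearly on the derivative.
\<close>

lemma C2_on_gradient:
  fixes F :: "'a::euclidean_space \<Rightarrow> real"
  assumes "C2_on S F"
  obtains G where "\<And>u. u \<in> S \<Longrightarrow> (F has_derivative (\<lambda>h. G u \<bullet> h)) (at u within S)"
    and "\<And>u. u \<in> S \<Longrightarrow> G differentiable (at u within S)"
proof -
  obtain f' :: "'a \<Rightarrow> 'a \<Rightarrow>\<^sub>L real" and f'' :: "'a \<Rightarrow> 'a \<Rightarrow>\<^sub>L ('a \<Rightarrow>\<^sub>L real)" where
    f': "\<And>u. u \<in> S \<Longrightarrow> (F has_derivative blinfun_apply (f' u)) (at u within S)" and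
    f'': "\<And>u. u \<in> S \<Longrightarrow> (f' has_derivative blinfun_apply (f'' u)) (at u within S)"
    using assms unfolding C2_on_def by blast
  define G where "G u = (\<Sum>b\<in>Basis. blinfun_apply (f' u) b *\<^sub>R b)" for u
  have "blinfun_apply (f' u) = (\<lambda>h. G u \<bullet> h)" for u
  proof
    fix h
    have "blinfun_apply (f' u) h = blinfun_apply (f' u) (\<Sum>b\<in>Basis. (h \<bullet> b) *\<^sub>R b)"
      by (simp add: euclidean_representation)
    also have "\<dots> = (\<Sum>b\<in>Basis. (h \<bullet> b) * blinfun_apply (f' u) b)"
      by (simp add: blinfun.sum_right blinfun.scaleR_right)
    also have "\<dots> = G u \<bullet> h"
      by (simp add: G_def inner_sum_left inner_commute[of h] mult.commute)
    finally show "blinfun_apply (f' u) h = G u \<bullet> h" .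
  qed
  then have "(F has_derivative (\<lambda>h. G u \<bullet> h)) (at u within S)" if "u \<in> S" for u
    using f'[OF that] by simp
  moreover have "G differentiable (at u within S)" if u: "u \<in> S" for u
  proof -
    have "((\<lambda>u. blinfun_apply (f' u) b) has_derivative (\<lambda>h. blinfun_apply (blinfun_apply (f'' u) h) b)) (at u within S)" for b
      by (rule bounded_linear.has_derivative[OF blinfun.bounded_linear_left f''[OF u]])
    then have "(G has_derivative (\<lambda>h. \<Sum>b\<in>Basis. blinfun_apply (blinfun_apply (f'' u) h) b *\<^sub>R b)) (at u within S)"
      unfolding G_def by (intro has_derivative_sum has_derivative_scaleR_left)
    then show ?thesis unfolding differentiable_def by blast
  qed
  ultimately show ?thesis using that by blast
qed

section \<open>The projected saddle-point dynamics as a saddle flow\<close>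

lemma has_derivative_first_slice:
  assumes "(F has_derivative F') (at (x, w) within UNIV \<times> W)" and w: "w \<in> W"
  shows "((\<lambda>x. F (x, w)) has_derivative (\<lambda>h. F' (h, 0))) (at x)"
proof (rule has_derivative_in_compose[where f = "\<lambda>x. (x, w)"])
  show "((\<lambda>x. (x, w)) has_derivative (\<lambda>h. (h, 0))) (at x)"
    by (auto intro!: derivative_eq_intros)
  show "(F has_derivative F') (at (x, w) within range (\<lambda>x. (x, w)))"
    by (rule has_derivative_subset[OF assms(1)]) (use w in auto)
qed

lemma has_derivative_second_slice:
  assumes "(F has_derivative F') (at (x, w) within X \<times> W)" and x: "x \<in> X"
  shows "((\<lambda>w. F (x, w)) has_derivative (\<lambda>h. F' (0, h))) (at w within W)"
proof (rule has_derivative_in_compose[where f = "\<lambda>w. (x, w)"])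
  show "((\<lambda>w. (x, w)) has_derivative (\<lambda>h. (0, h))) (at w within W)"
    by (auto intro!: derivative_eq_intros)
  show "(F has_derivative F') (at (x, w) within (\<lambda>w. (x, w)) ` W)"
    by (rule has_derivative_subset[OF assms(1)]) (use x in auto)
qed


lemma grad_x_eq:
  assumes F: "(F has_derivative (\<lambda>h. g \<bullet> h)) (at (x, y, z) within state_dom)" and yz: "(y, z) \<in> YZ_dom"
  shows "grad_x F (x, y, z) = fst g"
proof -
  have "((\<lambda>x. F (x, y, z)) has_derivative (\<lambda>h. fst g \<bullet> h)) (at x)"
    using has_derivative_first_slice[OF F[unfolded state_dom_def] yz] by (simp add: inner_prod_def)
  then show ?thesis
    using grad_on_eq[OF _ coordinate_accessible_UNIV] by (simp add: grad_x_def)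
qed

lemma grad_y_grad_z_eq:
  fixes F :: "('n::finite, 'p::finite, 'm::finite) state \<Rightarrow> real"
  assumes F: "(F has_derivative (\<lambda>h. g \<bullet> h)) (at (x, y, z) within state_dom)" and yz: "(y, z) \<in> YZ_dom"
  shows "grad_y F (x, y, z) = fst (snd g)" "grad_z F (x, y, z) = snd (snd g)"
proof -
  have y: "y \<in> nonneg_orthant" using yz by (simp add: YZ_dom_def)
  have yz_der: "((\<lambda>yz. F (x, yz)) has_derivative (\<lambda>h. snd g \<bullet> h)) (at (y, z) within nonneg_orthant \<times> UNIV)"
    using has_derivative_second_slice[OF F[unfolded state_dom_def] UNIV_I]
    by (simp add: inner_prod_def YZ_dom_def)
  have "((\<lambda>z. F (x, y, z)) has_derivative (\<lambda>h. snd (snd g) \<bullet> h)) (at z)"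
    using has_derivative_second_slice[OF yz_der y] by (simp add: inner_prod_def)
  then show "grad_z F (x, y, z) = snd (snd g)"
    using grad_on_eq[OF _ coordinate_accessible_UNIV] by (simp add: grad_z_def)
  have "((\<lambda>y. F (x, y, z)) has_derivative (\<lambda>h. snd g \<bullet> (h, 0))) (at y within nonneg_orthant)"
  proof (rule has_derivative_in_compose[where f = "\<lambda>y. (y, z)" and g = "\<lambda>yz. F (x, yz)"])
    show "((\<lambda>y. (y, z)) has_derivative (\<lambda>h. (h, 0))) (at y within nonneg_orthant)"
      by (auto intro!: derivative_eq_intros)
    show "((\<lambda>yz. F (x, yz)) has_derivative (\<lambda>h. snd g \<bullet> h)) (at (y, z) within (\<lambda>y. (y, z)) ` nonneg_orthant)"
      by (rule has_derivative_subset[OF yz_der]) auto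
  qed
  then have "((\<lambda>y. F (x, y, z)) has_derivative (\<lambda>h. fst (snd g) \<bullet> h)) (at y within nonneg_orthant)"
    by (simp add: inner_prod_def)
  then show "grad_y F (x, y, z) = fst (snd g)"
    using grad_on_eq[OF _ coordinate_accessible_nonneg_orthant y] by (simp add: grad_y_def)
qed

text \<open>
  The projection changes a component of \<open>g\<close> only where \<open>y\<close> is zero, and then only increases it,
  while the corresponding component of \<open>v - y\<close> is nonnegative there.
\<close>

lemma proj_plus_vec_variational:
  assumes "y \<in> nonneg_orthant" "v \<in> nonneg_orthant"
  shows "g \<bullet> (v - y) \<le> proj_plus_vec g y \<bullet> (v - y)"
  unfolding inner_vec_def
proof (rule sum_mono)
  fix i
  have "0 \<le> y $ i" "0 \<le> v $ i" using assms by (auto simp: nonneg_orthant_def)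
  then show "g $ i \<bullet> (v - y) $ i \<le> proj_plus_vec g y $ i \<bullet> (v - y) $ i"
    by (auto simp: proj_plus_vec_def proj_plus_def intro: mult_right_mono)
qed

text \<open>
  The tangent inequalities for the convex function \<open>F (\<cdot>, w)\<close> and the concave function
  \<open>F (x, \<cdot>)\<close>; by the previous lemma the projection only helps in the second one.
\<close>

lemma saddle_field_variational:
  fixes F :: "('n::finite, 'p::finite, 'm::finite) state \<Rightarrow> real"
  assumes cc: "convex_concave F" and w: "w \<in> YZ_dom"
    and F: "(F has_derivative (\<lambda>h. g \<bullet> h)) (at (x, w) within state_dom)"
  shows "F (x, w) - F (v, w) \<le> fst (saddle_field F (x, w)) \<bullet> (v - x)"
    and "u \<in> YZ_dom \<Longrightarrow> F (x, u) - F (x, w) \<le> snd (saddle_field F (x, w)) \<bullet> (u - w)"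
proof -
  obtain y z where w_eq: "w = (y, z)" by fastforce
  have fx: "fst (saddle_field F (x, w)) = - fst g"
    using grad_x_eq[of F g x y z] F w by (simp add: saddle_field_def w_eq)
  have "((\<lambda>x. F (x, w)) has_derivative (\<lambda>h. fst g \<bullet> h)) (at x)"
    using has_derivative_first_slice[OF F[unfolded state_dom_def] w] by (simp add: inner_prod_def)
  moreover have "convex_on UNIV (\<lambda>x. F (x, w))"
    using cc w by (simp add: convex_concave_def)
  ultimately have "F (x, w) + fst g \<bullet> (v - x) \<le> F (v, w)"
    using convex_on_above_tangent[of UNIV "\<lambda>x. F (x, w)" "\<lambda>h. fst g \<bullet> h" x v] by simp
  then show "F (x, w) - F (v, w) \<le> fst (saddle_field F (x, w)) \<bullet> (v - x)"
    by (simp add: fx)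
  assume u: "u \<in> YZ_dom"
  obtain y' z' where u_eq: "u = (y', z')" by fastforce
  have fw: "snd (saddle_field F (x, w)) = (proj_plus_vec (fst (snd g)) y, snd (snd g))"
    using grad_y_grad_z_eq[of F g x y z] F w by (simp add: saddle_field_def w_eq)
  have "((\<lambda>w. F (x, w)) has_derivative (\<lambda>h. snd g \<bullet> h)) (at w within YZ_dom)"
    using has_derivative_second_slice[OF F[unfolded state_dom_def] UNIV_I] by (simp add: inner_prod_def)
  then have "((\<lambda>w. - F (x, w)) has_derivative (\<lambda>h. - (snd g \<bullet> h))) (at w within YZ_dom)"
    by (rule has_derivative_minus)
  moreover have "convex_on YZ_dom (\<lambda>w. - F (x, w))"
    using cc by (simp add: convex_concave_def concave_on_def)
  ultimately have "- F (x, w) + - (snd g \<bullet> (u - w)) \<le> - F (x, u)"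
    using convex_on_above_tangent[of YZ_dom "\<lambda>w. - F (x, w)"] w u by blast
  moreover have "snd g \<bullet> (u - w) \<le> snd (saddle_field F (x, w)) \<bullet> (u - w)"
    using proj_plus_vec_variational[of y y' "fst (snd g)"] w u
    unfolding fw by (simp add: inner_prod_def w_eq u_eq YZ_dom_def)
  ultimately show "F (x, u) - F (x, w) \<le> snd (saddle_field F (x, w)) \<bullet> (u - w)"
    by linarith
qed

lemma closed_nonneg_orthant: "closed (nonneg_orthant :: (real ^ 'p::finite) set)"
  unfolding nonneg_orthant_def
  by (intro closed_Collect_all closed_Collect_le continuous_intros)

lemma closed_YZ_dom: "closed YZ_dom"
  unfolding YZ_dom_def by (intro closed_Times closed_nonneg_orthant closed_UNIV)

lemma Saddle_eq_saddle_points: "Saddle F = saddle_points UNIV YZ_dom F"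
  by (auto simp: Saddle_def saddle_points_def state_dom_def)

lemma saddle_trajectory_saddle_flow:
  fixes F :: "('n::finite, 'p::finite, 'm::finite) state \<Rightarrow> real"
  assumes C2: "C2_on state_dom F" and cc: "convex_concave F"
    and \<gamma>: "\<gamma> \<in> saddle_trajectories F"
  shows "\<exists>N. saddle_flow UNIV YZ_dom F (\<lambda>t. fst (\<gamma> t)) (\<lambda>t. snd (\<gamma> t)) N"
proof -
  obtain G where G: "\<And>u. u \<in> state_dom \<Longrightarrow> (F has_derivative (\<lambda>h. G u \<bullet> h)) (at u within state_dom)"
    using C2_on_gradient[OF C2] by (metis (no_types))
  have dom: "\<gamma> t \<in> UNIV \<times> YZ_dom" if "t \<ge> 0" for t
    using \<gamma> that by (auto simp: saddle_trajectories_def caratheodory_solutions_def state_dom_def)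
  have ac: "absolutely_continuous_on {0..T} \<gamma>" if "T \<ge> 0" for T
    using \<gamma> that by (auto simp: saddle_trajectories_def caratheodory_solutions_def)
  have "AE t in lebesgue_on {0..}. (\<gamma> has_vector_derivative saddle_field F (\<gamma> t)) (at t within {0..})"
    using \<gamma> by (auto simp: saddle_trajectories_def caratheodory_solutions_def)
  then have "AE t in lebesgue. t \<in> {0..} \<longrightarrow> (\<gamma> has_vector_derivative saddle_field F (\<gamma> t)) (at t within {0..})"
    by (subst (asm) AE_restrict_space_iff) auto
  then obtain N where N: "negligible N"
    and der: "\<And>t. t \<ge> 0 \<Longrightarrow> t \<notin> N \<Longrightarrow> (\<gamma> has_vector_derivative saddle_field F (\<gamma> t)) (at t within {0..})"
    by (auto elim!: AE_E3 simp: negligible_iff_null_sets)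
  have "saddle_flow UNIV YZ_dom F (\<lambda>t. fst (\<gamma> t)) (\<lambda>t. snd (\<gamma> t)) N"
  proof
    show "continuous_on (UNIV \<times> YZ_dom) F"
      using G has_derivative_continuous unfolding continuous_on_eq_continuous_within state_dom_def by blast
    fix t :: real assume t: "t \<ge> 0" "t \<notin> N"
    have "snd (\<gamma> t) \<in> YZ_dom" "\<gamma> t \<in> state_dom"
      using dom[OF t(1)] by (auto simp: state_dom_def mem_Times_iff)
    then show "\<exists>x' w'. ((\<lambda>t. (fst (\<gamma> t), snd (\<gamma> t))) has_vector_derivative (x', w')) (at t within {0..}) \<and>
        (\<forall>v\<in>UNIV. F (fst (\<gamma> t), snd (\<gamma> t)) - F (v, snd (\<gamma> t)) \<le> x' \<bullet> (v - fst (\<gamma> t))) \<and>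
        (\<forall>v\<in>YZ_dom. F (fst (\<gamma> t), v) - F (fst (\<gamma> t), snd (\<gamma> t)) \<le> w' \<bullet> (v - snd (\<gamma> t)))"
      using der[OF t] saddle_field_variational[OF cc, of "snd (\<gamma> t)" "G (\<gamma> t)" "fst (\<gamma> t)"] G
      by (intro exI[of _ "fst (saddle_field F (\<gamma> t))"] exI[of _ "snd (saddle_field F (\<gamma> t))"]) simp
  qed (use dom ac N closed_YZ_dom in \<open>auto simp: mem_Times_iff\<close>)
  then show ?thesis ..
qed

text \<open>
  A definite Hessian block at a single saddle point has this global effect because minimizers of
  a convex function form a convex set: a second one would yield a flat segment ending at the first.
\<close>

lemma locally_strong_saddle_unique:
  fixes F :: "('n::finite, 'p::finite, 'm::finite) state \<Rightarrow> real"
  assumes C2: "C2_on state_dom F" and s: "(p, q) \<in> saddle_points UNIV YZ_dom F"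
    and strong: "locally_strongly_convex_concave F (p, q)"
  shows "(\<forall>v. F (v, q) = F (p, q) \<longrightarrow> v = p) \<or> (\<forall>w\<in>YZ_dom. F (p, w) = F (p, q) \<longrightarrow> w = q)"
proof -
  have q: "q \<in> YZ_dom" using s by (simp add: saddle_points_def)
  then have pq: "(p, q) \<in> state_dom" by (simp add: state_dom_def)
  obtain G where G: "\<And>u. u \<in> state_dom \<Longrightarrow> (F has_derivative (\<lambda>h. G u \<bullet> h)) (at u within state_dom)"
    and dG: "\<And>u. u \<in> state_dom \<Longrightarrow> G differentiable (at u within state_dom)"
    using C2_on_gradient[OF C2] by (metis (no_types))
  obtain G' where G': "(G has_derivative G') (at (p, q) within UNIV \<times> YZ_dom)"
    using dG[OF pq] unfolding differentiable_def state_dom_def by blast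
  have cc: "convex_concave F" using strong by (simp add: locally_strongly_convex_concave_def)
  obtain c where "c > 0"
    and c: "loewner_le (\<lambda>h. c *\<^sub>R h) (hess_xx F (p, q)) \<or> loewner_le (hess_yz F (p, q)) (\<lambda>h. - c *\<^sub>R h)"
    using strong by (auto simp: locally_strongly_convex_concave_def)
  from c show ?thesis
  proof
    assume le: "loewner_le (\<lambda>h. c *\<^sub>R h) (hess_xx F (p, q))"
    let ?f = "\<lambda>x. F (x, q)" and ?g = "\<lambda>x. fst (G (x, q))"
    have der: "(?f has_derivative (\<lambda>h. ?g u \<bullet> h)) (at u)" for u
      using has_derivative_first_slice[OF G[unfolded state_dom_def] q] q by (simp add: inner_prod_def)
    have "?g differentiable (at p)"
      unfolding differentiable_def
      using bounded_linear.has_derivative[OF bounded_linear_fst has_derivative_first_slice[OF G' q]] by blast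
    then have "(?g has_derivative hess_on UNIV ?f p) (at p)"
      using has_derivative_hess_on[of UNIV ?f ?g p] der coordinate_accessible_UNIV by blast
    moreover have "c * (h \<bullet> h) \<le> h \<bullet> hess_on UNIV ?f p h" for h
      using le by (simp add: loewner_le_def hess_xx_def)
    moreover have "convex_on UNIV ?f" using cc q by (simp add: convex_concave_def)
    moreover have "?f p \<le> ?f u" for u using s by (simp add: saddle_points_def)
    ultimately have "v = p" if "F (v, q) = F (p, q)" for v
      using unique_minimizer_of_positive_hessian[of UNIV ?f ?g "hess_on UNIV ?f p" p c v] der \<open>c > 0\<close> that
      by simp
    then show ?thesis by blast
  next
    assume le: "loewner_le (hess_yz F (p, q)) (\<lambda>h. - c *\<^sub>R h)"
    let ?f = "\<lambda>w. F (p, w)" and ?g = "\<lambda>w. snd (G (p, w))"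
    have der: "(?f has_derivative (\<lambda>h. ?g u \<bullet> h)) (at u within YZ_dom)" if "u \<in> YZ_dom" for u
      using has_derivative_second_slice[OF G[unfolded state_dom_def] UNIV_I] that by (simp add: inner_prod_def)
    have "?g differentiable (at q within YZ_dom)"
      unfolding differentiable_def
      using bounded_linear.has_derivative[OF bounded_linear_snd has_derivative_second_slice[OF G' UNIV_I]] by blast
    then have "(?g has_derivative hess_on YZ_dom ?f q) (at q within YZ_dom)"
      using has_derivative_hess_on[of YZ_dom ?f ?g q] der coordinate_accessible_YZ_dom q by blast
    then have "((\<lambda>w. - ?g w) has_derivative (\<lambda>h. - hess_on YZ_dom ?f q h)) (at q within YZ_dom)"
      by (rule has_derivative_minus)
    moreover have "c * (h \<bullet> h) \<le> h \<bullet> - hess_on YZ_dom ?f q h" for h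
      using le[unfolded loewner_le_def, rule_format, of h] by (simp add: hess_yz_def)
    moreover have "convex_on YZ_dom (\<lambda>w. - ?f w)" using cc by (simp add: convex_concave_def concave_on_def)
    moreover have "- ?f q \<le> - ?f u" if "u \<in> YZ_dom" for u using s that by (simp add: saddle_points_def)
    moreover have "((\<lambda>w. - ?f w) has_derivative (\<lambda>h. - ?g u \<bullet> h)) (at u within YZ_dom)" if "u \<in> YZ_dom" for u
      using has_derivative_minus[OF der[OF that]] by simp
    ultimately have "w = q" if "w \<in> YZ_dom" "F (p, w) = F (p, q)" for w
      using unique_minimizer_of_positive_hessian[of YZ_dom "\<lambda>w. - ?f w" "\<lambda>w. - ?g w"
          "\<lambda>h. - hess_on YZ_dom ?f q h" q c w] \<open>c > 0\<close> that q
      by simp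
    then show ?thesis by blast
  qed
qed

section \<open>Global asymptotic stability of the saddle points\<close>

theorem theorem4p2:
  fixes F :: "(real ^ 'n) \<times> (real ^ 'p) \<times> (real ^ 'm) \<Rightarrow> real"
    and s :: "(real ^ 'n) \<times> (real ^ 'p) \<times> (real ^ 'm)"
  assumes "C2_on state_dom F"
    and "convex_concave F"
    and "s \<in> Saddle F"
    and "locally_strongly_convex_concave F s"
  shows "globally_asymptotically_stable (saddle_trajectories F) (Saddle F) \<and>
    (\<forall>\<gamma>\<in>saddle_trajectories F. \<exists>q\<in>Saddle F. (\<gamma> \<longlongrightarrow> q) at_top)"
proof -
  obtain p q where s_eq: "s = (p, q)" by (cases s)
  have saddle: "(p, q) \<in> saddle_points UNIV YZ_dom F"
    using assms(3) by (simp add: s_eq Saddle_eq_saddle_points)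
  have conv: "\<exists>r\<in>Saddle F. (\<gamma> \<longlongrightarrow> r) at_top" if \<gamma>: "\<gamma> \<in> saddle_trajectories F" for \<gamma>
  proof -
    obtain N where flow: "saddle_flow UNIV YZ_dom F (\<lambda>t. fst (\<gamma> t)) (\<lambda>t. snd (\<gamma> t)) N"
      using saddle_trajectory_saddle_flow[OF assms(1,2) \<gamma>] by blast
    from locally_strong_saddle_unique[OF assms(1) saddle assms(4)[unfolded s_eq]] show ?thesis
    proof
      assume "\<forall>v. F (v, q) = F (p, q) \<longrightarrow> v = p"
      then show ?thesis
        using saddle_flow.tendsto_saddle_point[OF flow saddle] by (simp add: Saddle_eq_saddle_points)
    next
      assume uniq: "\<forall>w\<in>YZ_dom. F (p, w) = F (p, q) \<longrightarrow> w = q"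
      let ?F' = "\<lambda>(v, u). - F (u, v)"
      have swap: "(w, x) \<in> saddle_points YZ_dom UNIV ?F' \<longleftrightarrow> (x, w) \<in> saddle_points UNIV YZ_dom F" for x w
        by (auto simp: saddle_points_def)
      have "\<exists>z \<in> saddle_points YZ_dom UNIV ?F'. ((\<lambda>t. (snd (\<gamma> t), fst (\<gamma> t))) \<longlongrightarrow> z) at_top"
        by (rule saddle_flow.tendsto_saddle_point[OF saddle_flow.swapped[OF flow], of q p])
          (use saddle uniq swap in auto)
      then obtain w x where wx: "(w, x) \<in> saddle_points YZ_dom UNIV ?F'"
        and lim: "((\<lambda>t. (snd (\<gamma> t), fst (\<gamma> t))) \<longlongrightarrow> (w, x)) at_top"
        by auto
      have "(\<gamma> \<longlongrightarrow> (x, w)) at_top"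
        using tendsto_Pair[OF tendsto_snd[OF lim] tendsto_fst[OF lim]] by simp
      then show ?thesis using wx swap by (auto simp: Saddle_eq_saddle_points)
    qed
  qed
  have nonempty: "Saddle F \<noteq> {}" using assms(3) by blast
  have stable: "infdist (\<gamma> t) (Saddle F) \<le> infdist (\<gamma> 0) (Saddle F)"
    if \<gamma>: "\<gamma> \<in> saddle_trajectories F" and t: "t \<ge> 0" for \<gamma> t
  proof -
    obtain N where flow: "saddle_flow UNIV YZ_dom F (\<lambda>t. fst (\<gamma> t)) (\<lambda>t. snd (\<gamma> t)) N"
      using saddle_trajectory_saddle_flow[OF assms(1,2) \<gamma>] by blast
    have "infdist (\<gamma> t) (Saddle F) \<le> dist (\<gamma> 0) r" if r: "r \<in> Saddle F" for r
    proof -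
      have "dist (\<gamma> t) r \<le> dist (\<gamma> 0) r"
        using saddle_flow.fejer[OF flow, of "fst r" "snd r" 0 t] r t by (simp add: Saddle_eq_saddle_points)
      then show ?thesis using infdist_le[OF r, of "\<gamma> t"] by linarith
    qed
    then show ?thesis
      using nonempty by (simp add: infdist_notempty[of _ "\<gamma> 0"] cINF_greatest)
  qed
  have attractive: "((\<lambda>t. infdist (\<gamma> t) (Saddle F)) \<longlongrightarrow> 0) at_top" if \<gamma>: "\<gamma> \<in> saddle_trajectories F" for \<gamma>
  proof -
    obtain r where "r \<in> Saddle F" "(\<gamma> \<longlongrightarrow> r) at_top" using conv[OF \<gamma>] by blast
    then show ?thesis using tendsto_infdist[of \<gamma> r at_top "Saddle F"] by simp
  qed
  have "lyapunov_stable (saddle_trajectories F) (Saddle F)"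
    unfolding lyapunov_stable_def using stable by (meson order_le_less_trans)
  then show ?thesis
    using attractive conv unfolding globally_asymptotically_stable_def by blast
qed

end
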